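(* Let $1\le p\le\infty$, let $q$ be the conjugate exponent of $p$ ($q=\infty$ if $p=1$, $q=1$ if $p=\infty$), and let $A=(a_{nk})_{n,k\in\mathbb N_0}$ be an infinite real matrix. Put $$\widehat a_{nk}=\lambda_k\left\{\frac{f_{k+1}^2a_{nk}}{(\lambda_k-\lambda_{k-1})f_kf_{k+1}}+\left[\frac1{(\lambda_k-\lambda_{k-1})f_kf_{k+1}}-\frac1{(\lambda_{k+1}-\lambda_k)f_{k+1}f_{k+2}}\right]\sum_{j=k+1}^\infty f_{j+1}^2a_{nj}\right\},$$ $\widehat A_n=(\widehat a_{nk})_{k\in\mathbb N_0}$, $\mathbb N_r=\{n\in\mathbb N_0:n\ge r\}$, and let $L_A$ be the operator $x\mapsto Ax$. (a) If $A\in(\ell_p^{\lambda}(\widehat F):c_0)$, then $L_A$ is compact if and only if: (i) for $p=\infty$, $\lim_{r\to\infty}\big(\sup_{n\in\mathbb N_r}\sum_k|\widehat a_{nk}|\big)=0$; (ii) for $1<p<\infty$, $\lim_{r\to\infty}\big[\sup_{n\in\mathbb N_r}\big(\sum_k|\widehat a_{nk}|^q\big)^{1/q}\big]=0$; (iii) for $p=1$, $\lim_{r\to\infty}\big(\sup_{n\in\mathbb N_r,\,k\in\mathbb N_0}|\widehat a_{nk}|\big)=0$. (b) If $A\in(\ell_p^{\lambda}(\widehat F):\ell_1)$, then $L_A$ is compact if and only if: (i) for $1<p\le\infty$, $\lim_{r\to\infty}\big(\sup_N\|\sum_{n\in N}\widehat A_n\|_q\big)=0$, where for each $r$ the supremum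 is over all finite subsets $N$ of $\mathbb N_r$; (ii) for $p=1$, $\lim_{r\to\infty}\big(\sup_{k\in\mathbb N_0}\sum_{n=r}^\infty|\widehat a_{nk}|\big)=0$. (c) If $A\in(\ell_p^{\lambda}(\widehat F):c)$, then $L_A$ is compact if and only if $$\lim_{r\to\infty}\Big(\sup_{n\in\mathbb N_r}\|\widehat A_n-\widehat\alpha\|_q\Big)=0,$$ where $\widehat\alpha=(\widehat\alpha_k)_{k\in\mathbb N_0}$ with $\widehat\alpha_k=\lim_{n\to\infty}\widehat a_{nk}$ for all $k$.
   Context: $\mathbb N_0=\{0,1,2,\dots\}$; sums without limits run from $0$ to $\infty$; $\omega$ is the space of all real sequences $x=(x_k)_{k\in\mathbb N_0}$; $c_0,c$ carry the sup norm. Fibonacci numbers: $f_0=f_1=1$, $f_n=f_{n-1}+f_{n-2}$ for $n\ge 2$. $\lambda=(\lambda_k)_{k\in\mathbb N_0}$ is a fixed strictly increasing sequence of positive reals with $\lambda_k\to\infty$. Terms with negative subscript are $0$ (so $\lambda_{-1}=0$, $x_{-1}=0$). For $x\in\omega$ put $$E_n(x)=\frac1{\lambda_n}\sum_{k=0}^n(\lambda_k-\lambda_{k-1})\Big(\frac{f_k}{f_{k+1}}x_k-\frac{f_{k+1}}{f_k}x_{k-1}\Big),\qquad Ex=(E_n(x))_{n\in\mathbb N_0},$$ and $\ell_p^{\lambda}(\widehat F)=\{x\in\omega: Ex\in\ell_p\}$ with norm $\|x\|=\|Ex\|_p$, $1\le p\le\infty$. For sequence spaces $X,Y$, $A\in(X:Y)$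 means that for every $x\in X$ the series $A_n(x)=\sum_ka_{nk}x_k$ converges for every $n$ and $Ax=(A_n(x))_n\in Y$; then $L_A:X\to Y$, $L_Ax=Ax$. The series defining $\widehat a_{nk}$ converge whenever $A$ belongs to one of the classes considered. A linear operator $L:X\to Y$ between Banach spaces is compact if for every bounded sequence $(x_n)$ in $X$ the sequence $(Lx_n)$ has a convergent subsequence in $Y$. *)

theory Defs
  imports "HOL-Analysis.Analysis" "HOL-Number_Theory.Fib"
begin

(* Sequences are indexed by {0, 1, 2, ...}.  Norms take values in ennreal, so that infinite
   sums and suprema keep their meaning where they diverge. *)

type_synonym rseq = "nat \<Rightarrow> real"
type_synonym matrix = "nat \<Rightarrow> nat \<Rightarrow> real"

subsection \<open>Classical sequence spaces\<close>

definition lp_norm :: "ennreal \<Rightarrow> rseq \<Rightarrow> ennreal" where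
  "lp_norm p x =
     (if p = \<infinity> then (SUP k. ennreal \<bar>x k\<bar>)
      else if summable (\<lambda>k. \<bar>x k\<bar> powr enn2real p)
        then ennreal ((\<Sum>k. \<bar>x k\<bar> powr enn2real p) powr (1 / enn2real p))
      else \<infinity>)"

definition ell :: "ennreal \<Rightarrow> rseq set" where
  "ell p = {x. lp_norm p x < \<infinity>}"

definition c_null :: "rseq set" where
  "c_null = {x. x \<longlonglongrightarrow> 0}"

definition c_conv :: "rseq set" where
  "c_conv = {x. convergent x}"

definition conjugate_exponents :: "ennreal \<Rightarrow> ennreal \<Rightarrow> bool" where
  "conjugate_exponents p q \<longleftrightarrow> 1 / p + 1 / q = 1"

lemma conjugate_exponents_1: "conjugate_exponents 1 q \<longleftrightarrow> q = \<infinity>"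
proof -
  have "(1::ennreal) + 1 / q = 1 \<longleftrightarrow> 1 / q = 0"
    using ennreal_add_left_cancel[of 1 "1 / q" 0] by simp
  then show ?thesis
    by (simp add: conjugate_exponents_def ennreal_divide_eq_0_iff)
qed

lemma conjugate_exponents_infinity: "conjugate_exponents \<infinity> q \<longleftrightarrow> q = 1"
  by (auto simp: conjugate_exponents_def divide_eq_1_ennreal)

subsection \<open>The spaces of lambda-Fibonacci sequences\<close>

(* The library's fib starts with fib 0 = 0; here fibo 0 = fibo 1 = 1. *)
definition fibo :: "nat \<Rightarrow> real" where
  "fibo n = real (fib (Suc n))"

lemma fibo_rec: "fibo 0 = 1" "fibo 1 = 1" "n \<ge> 2 \<Longrightarrow> fibo n = fibo (n - 1) + fibo (n - 2)"
  by (auto simp: fibo_def numeral_2_eq_2 Suc_le_eq less_iff_Suc_add)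

(* The term with index k - 1, read as 0 for k = 0. *)
definition prev :: "rseq \<Rightarrow> rseq" where
  "prev x k = (if k = 0 then 0 else x (k - 1))"

definition E_seq :: "rseq \<Rightarrow> rseq \<Rightarrow> rseq" where
  "E_seq lam x n = 1 / lam n *
     (\<Sum>k\<le>n. (lam k - prev lam k) * (fibo k / fibo (k + 1) * x k - fibo (k + 1) / fibo k * prev x k))"

definition ell_lam :: "rseq \<Rightarrow> ennreal \<Rightarrow> rseq set" where
  "ell_lam lam p = {x. E_seq lam x \<in> ell p}"

definition ell_lam_norm :: "rseq \<Rightarrow> ennreal \<Rightarrow> rseq \<Rightarrow> ennreal" where
  "ell_lam_norm lam p x = lp_norm p (E_seq lam x)"

subsection \<open>Matrix transformations and compact operators\<close>

definition mat_op :: "matrix \<Rightarrow> rseq \<Rightarrow> rseq" where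
  "mat_op A x = (\<lambda>n. \<Sum>k. A n k * x k)"

definition mat_class :: "rseq set \<Rightarrow> rseq set \<Rightarrow> matrix set" where
  "mat_class X Y =
     {A. \<forall>x\<in>X. (\<forall>n. summable (\<lambda>k. A n k * x k)) \<and> mat_op A x \<in> Y}"

(* X and Y are sequence spaces with norms NX and NY. *)
definition compact_operator ::
  "rseq set \<Rightarrow> (rseq \<Rightarrow> ennreal) \<Rightarrow> rseq set \<Rightarrow> (rseq \<Rightarrow> ennreal) \<Rightarrow> (rseq \<Rightarrow> rseq) \<Rightarrow> bool" where
  "compact_operator X NX Y NY L \<longleftrightarrow>
     (\<forall>x\<in>X. L x \<in> Y) \<and>
     (\<forall>x\<in>X. \<forall>y\<in>X. \<forall>a b. L (\<lambda>k. a * x k + b * y k) = (\<lambda>k. a * L x k + b * L y k)) \<and>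
     (\<forall>x :: nat \<Rightarrow> rseq. (\<forall>n. x n \<in> X) \<and> (\<exists>B::real. \<forall>n. NX (x n) \<le> ennreal B) \<longrightarrow>
        (\<exists>s. strict_mono s \<and>
          (\<exists>y\<in>Y. (\<lambda>n. NY (\<lambda>k. L (x (s n)) k - y k)) \<longlonglongrightarrow> 0)))"

(* The inner sum over j \<ge> k + 1 is shifted to start at 0. *)
definition ahat :: "rseq \<Rightarrow> matrix \<Rightarrow> matrix" where
  "ahat lam A n k = lam k *
     ((fibo (k + 1))\<^sup>2 * A n k / ((lam k - prev lam k) * fibo k * fibo (k + 1)) +
      (1 / ((lam k - prev lam k) * fibo k * fibo (k + 1))
        - 1 / ((lam (k + 1) - lam k) * fibo (k + 1) * fibo (k + 2))) *
      (\<Sum>i. (fibo (i + (k + 1) + 1))\<^sup>2 * A n (i + (k + 1))))"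

definition alphahat :: "rseq \<Rightarrow> matrix \<Rightarrow> rseq" where
  "alphahat lam A k = lim (\<lambda>n. ahat lam A n k)"

end

theory Submission
  imports Defs "HOL-Library.Diagonal_Subsequence"
begin

text \<open>\<open>E_seq lam\<close> is an isometric bijection from the domain space onto \<open>\<ell>\<^sub>p\<close>, and composing \<open>A\<close> with
  its inverse gives a matrix map on \<open>\<ell>\<^sub>p\<close> whose columns, the images of the unit vectors, are those of
  \<open>ahat lam A\<close>.  For \<open>p = \<infinity>\<close> the unit vectors do not span a dense subspace, so the
  representation needs Schur's theorem: a weakly convergent sequence in \<open>\<ell>\<^sub>1\<close> converges in norm.
  Applied to the products \<open>\<phi>\<^sub>m(k) y(k)\<close> with \<open>y\<close> fixed in \<open>\<ell>\<^sub>p\<close>, it handles all exponents at once.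
  In each target space an operator is then compact iff the tails of the images of the unit ball
  tend to \<open>0\<close> uniformly, and the suprema of these tails over the unit ball are computed by the
  duality of \<open>\<ell>\<^sub>p\<close> and \<open>\<ell>\<^sub>q\<close>.\<close>

text \<open>The formula for \<open>ahat\<close> comes from a telescope: the bracket in
  \<open>E_seq\<close> equals \<open>fibo k * fibo (k + 1) * (x k / (fibo (k + 1))^2 - prev x k /
  (fibo k)^2)\<close>, so inverting \<open>E_seq\<close> means summing increments, and summation by
  parts produces the difference of reciprocals. The obstacle is the passage to infinite sums. The
  first \<open>m\<close> terms of a row series can be rewritten in \<open>y = E_seq lam x\<close>,
  but letting \<open>m\<close> grow under the sum over \<open>j\<close> has no dominating sequence.
  What helps is that \<open>ell p\<close> is stable under bounded multipliers \<open>z\<close>: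
  convergence of the row series on the whole space then says that the products with \<open>y\<close>
  converge when tested against every \<open>z\<close>. The same device lets the limit over the rows
  pass under the sum over the columns when the target is \<open>c_conv\<close>. All exponents are
  handled together because each norm is a supremum of pairings with values in
  \<open>ennreal\<close>, infinite values included.\<close>

subsection \<open>Duality of the sequence norms\<close>

(* This conditional rule reappears in its own premise and makes the simplifier run away. *)
declare suminf_ennreal [simp del]

lemma lp_norm_infinity: "lp_norm \<infinity> x = (SUP k. ennreal \<bar>x k\<bar>)"
  by (simp add: lp_norm_def)

lemma lp_norm_1: "lp_norm 1 x = (\<Sum>k. ennreal \<bar>x k\<bar>)"
proof (cases "summable (\<lambda>k. \<bar>x k\<bar>)")
  case True
  then show ?thesis
    by (simp add: lp_norm_def suminf_nonneg suminf_ennreal2)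
next
  case False
  then have "(\<Sum>k. ennreal \<bar>x k\<bar>) = \<infinity>"
    using summable_suminf_not_top[of "\<lambda>k. \<bar>x k\<bar>"] by auto
  with False show ?thesis
    by (simp add: lp_norm_def)
qed

text \<open>The partial-sum form carries summability and the bound at once, so finite inequalities
  suffice for real exponents.\<close>

lemma lp_norm_le_iff:
  assumes "0 < P" "0 \<le> c"
  shows "lp_norm (ennreal P) x \<le> ennreal c \<longleftrightarrow> (\<forall>m. (\<Sum>k<m. \<bar>x k\<bar> powr P) \<le> c powr P)"
proof
  assume le: "lp_norm (ennreal P) x \<le> ennreal c"
  then have sm: "summable (\<lambda>k. \<bar>x k\<bar> powr P)"
    using assms by (auto simp: lp_norm_def top_unique split: if_splits)
  then have "ennreal ((\<Sum>k. \<bar>x k\<bar> powr P) powr (1 / P)) \<le> ennreal c"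
    using le assms by (simp add: lp_norm_def)
  then have "(\<Sum>k. \<bar>x k\<bar> powr P) powr (1 / P) \<le> c"
    using assms by simp
  then have "((\<Sum>k. \<bar>x k\<bar> powr P) powr (1 / P)) powr P \<le> c powr P"
    using assms by (intro powr_mono2) auto
  then have "(\<Sum>k. \<bar>x k\<bar> powr P) \<le> c powr P"
    using assms sm by (simp add: powr_powr suminf_nonneg)
  then show "\<forall>m. (\<Sum>k<m. \<bar>x k\<bar> powr P) \<le> c powr P"
    using sum_le_suminf[OF sm] by (meson finite_lessThan order_trans powr_ge_zero)
next
  assume le: "\<forall>m. (\<Sum>k<m. \<bar>x k\<bar> powr P) \<le> c powr P"
  then have sm: "summable (\<lambda>k. \<bar>x k\<bar> powr P)"
    by (intro summableI_nonneg_bounded) auto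
  then have "(\<Sum>k. \<bar>x k\<bar> powr P) \<le> c powr P"
    using le suminf_le_const by blast
  then have "(\<Sum>k. \<bar>x k\<bar> powr P) powr (1 / P) \<le> (c powr P) powr (1 / P)"
    using assms sm by (intro powr_mono2 suminf_nonneg) auto
  then show "lp_norm (ennreal P) x \<le> ennreal c"
    using assms sm by (simp add: lp_norm_def powr_powr ennreal_leI)
qed

section \<open>Arithmetic of conjugate exponents\<close>

lemma conjugate_exponents_real:
  assumes "conjugate_exponents p q" "1 < p" "p < \<infinity>"
  obtains P Q :: real where "p = ennreal P" "q = ennreal Q" "1 < P" "1 < Q" "1 / P + 1 / Q = 1"
proof -
  obtain P where P: "p = ennreal P" "1 < P"
    using assms(2,3) by (cases p) auto
  have eq: "1 / p + 1 / q = 1"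
    using assms(1) by (simp add: conjugate_exponents_def)
  have ip: "1 / p = ennreal (1 / P)"
    using P by (metis divide_ennreal ennreal_1 less_trans zero_le_one zero_less_one)
  \<comment> \<open>\<open>q = 0\<close> would make \<open>1 / q\<close> infinite, and
    \<open>q = \<infinity>\<close> would force \<open>1 / p = 1\<close>, against
    \<open>1 < P\<close>.\<close>
  have "q \<noteq> 0"
    using eq by (auto simp: ennreal_divide_zero)
  moreover have "q \<noteq> \<infinity>"
    using eq ip P by (auto simp flip: ennreal_1)
  ultimately obtain Q where Q: "q = ennreal Q" "0 < Q"
    by (cases q) (auto simp: less_le)
  have "1 / q = ennreal (1 / Q)"
    using Q by (metis divide_ennreal ennreal_1 zero_le_one)
  then have "ennreal (1 / P + 1 / Q) = ennreal 1"
    using eq ip P Q by (subst ennreal_plus) auto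
  then have s: "1 / P + 1 / Q = 1"
    using P Q by (subst (asm) ennreal_inj) (auto intro!: add_nonneg_nonneg)
  then have "1 / Q < 1"
    using P by (smt (verit) divide_pos_pos)
  then have "1 < Q"
    using Q by (simp add: field_simps)
  then show thesis
    using that P Q s by blast
qed

lemma conjugate_exponents_sym: "conjugate_exponents p q \<Longrightarrow> conjugate_exponents q p"
  by (simp add: conjugate_exponents_def add.commute)

text \<open>Makes the roles of \<open>p\<close> and \<open>q\<close> interchangeable:
  \<open>q < 1\<close> would already give \<open>1 / q > 1\<close>.\<close>

lemma conjugate_exponents_ge_1:
  assumes "conjugate_exponents p q" shows "1 \<le> q"
proof (rule ccontr)
  assume "\<not> 1 \<le> q"
  then obtain r where r: "q = ennreal r" "0 \<le> r" "r < 1"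
    by (cases q) (auto simp: not_le)
  have "1 < 1 / q"
  proof (cases "r = 0")
    case False
    then have "1 / q = ennreal (1 / r)"
      using r by (metis divide_ennreal ennreal_1 less_le zero_le_one)
    then show ?thesis
      using r False ennreal_less_iff[of 1 "1 / r"] by (simp add: field_simps)
  qed (use r in \<open>simp add: ennreal_divide_zero\<close>)
  also have "1 / q \<le> 1"
    using assms add_increasing[of "1 / p" "1 / q" "1 / q"] unfolding conjugate_exponents_def by simp
  finally show False by simp
qed

lemma conjugate_cases:
  assumes "conjugate_exponents p q" "1 \<le> p"
  obtains "p = 1" "q = \<infinity>" | "p = \<infinity>" "q = 1"
  | P Q :: real where "p = ennreal P" "q = ennreal Q" "1 < P" "1 < Q" "1 / P + 1 / Q = 1"
proof (cases "p = 1 \<or> p = \<infinity>")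
  case True
  then show ?thesis
    using that(1,2) assms by (auto simp: conjugate_exponents_1 conjugate_exponents_infinity[simplified])
next
  case False
  then have "1 < p" "p < \<infinity>"
    using assms(2) by (simp_all add: order.not_eq_order_implies_strict flip: top.not_eq_extremum)
  then show ?thesis
    using conjugate_exponents_real[OF assms(1)] that(3) by metis
qed

text \<open>Absolute values and \<open>ennreal\<close> give this a meaning for arbitrary sequences,
  so duality can be stated even where a norm is infinite.\<close>

definition pairing :: "rseq \<Rightarrow> rseq \<Rightarrow> ennreal" where
  "pairing a y = (\<Sum>k. ennreal \<bar>a k * y k\<bar>)"

definition unit_ball :: "ennreal \<Rightarrow> rseq set" where
  "unit_ball p = {y. lp_norm p y \<le> 1}"

lemma pairing_le_iff:
  assumes "0 \<le> c"
  shows "pairing a y \<le> ennreal c \<longleftrightarrow> (\<forall>m. (\<Sum>k<m. \<bar>a k * y k\<bar>) \<le> c)"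
  unfolding pairing_def suminf_eq_SUP SUP_le_iff using assms
  by (simp add: sum_ennreal)

text \<open>Hoelder's inequality from Young's: after division by the norm \<open>A\<close> of
  \<open>a\<close>, the Young bounds add up to \<open>1 / Q + 1 / P = 1\<close>. The case
  \<open>A = 0\<close> cannot be normalised and is treated apart.\<close>

lemma pairing_le_lp_norm:
  assumes "1 < P" "1 < Q" "1 / P + 1 / Q = 1" "y \<in> unit_ball (ennreal P)"
  shows "pairing a y \<le> lp_norm (ennreal Q) a"
proof (cases "lp_norm (ennreal Q) a")
  case (real A)
  have a: "(\<Sum>k<m. \<bar>a k\<bar> powr Q) \<le> A powr Q" for m
    using real assms lp_norm_le_iff[of Q A a] by simp
  have y: "(\<Sum>k<m. \<bar>y k\<bar> powr P) \<le> 1" for m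
    using assms lp_norm_le_iff[of P 1 y] by (simp add: unit_ball_def)
  have "(\<Sum>k<m. \<bar>a k * y k\<bar>) \<le> A" for m
  proof (cases "A = 0")
    case True
    then have "(\<Sum>k<m. \<bar>a k\<bar> powr Q) = 0"
      using a[of m] by (intro antisym sum_nonneg) auto
    then have "\<forall>k\<in>{..<m}. a k = 0"
      by (subst (asm) sum_nonneg_eq_0_iff) auto
    then show ?thesis
      using real by (auto intro!: sum_nonpos)
  next
    case False
    then have A: "0 < A" using real by simp
    have "(\<Sum>k<m. \<bar>a k * y k\<bar>) / A = (\<Sum>k<m. (\<bar>a k\<bar> / A) * \<bar>y k\<bar>)"
      by (simp add: sum_divide_distrib abs_mult)
    also have "\<dots> \<le> (\<Sum>k<m. (\<bar>a k\<bar> / A) powr Q / Q + \<bar>y k\<bar> powr P / P)"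
      using assms A by (intro sum_mono Youngs_inequality) (auto simp: add.commute)
    also have "\<dots> = (\<Sum>k<m. \<bar>a k\<bar> powr Q) / A powr Q / Q + (\<Sum>k<m. \<bar>y k\<bar> powr P) / P"
      using A by (simp add: sum.distrib sum_divide_distrib powr_divide)
    also have "\<dots> \<le> 1 / Q + 1 / P"
      using A assms a[of m] y[of m]
      by (intro add_mono divide_right_mono) (auto simp: divide_le_eq)
    finally show ?thesis
      using assms A by (simp add: field_simps)
  qed
  then show ?thesis
    using real by (simp add: pairing_le_iff)
qed simp

lemma lp_norm_le_SUP_pairing:
  assumes "1 < P" "1 < Q" "1 / P + 1 / Q = 1"
  shows "lp_norm (ennreal Q) a \<le> (SUP y\<in>unit_ball (ennreal P). pairing a y)"
proof (cases "SUP y\<in>unit_ball (ennreal P). pairing a y")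
  case (real s)
  have PQ: "P * (Q - 1) = Q" "1 - 1 / P = 1 / Q"
    using assms by (auto simp: field_simps)
  have "(\<Sum>k<m. \<bar>a k\<bar> powr Q) \<le> s powr Q" for m
  proof (cases "(\<Sum>k<m. \<bar>a k\<bar> powr Q) = 0")
    case False
    define t where "t = (\<Sum>k<m. \<bar>a k\<bar> powr Q)"
    have t: "0 < t"
      using False by (simp add: t_def less_le sum_nonneg)
    \<comment> \<open>The equality case of Hoelder: \<open>P * (Q - 1) = Q\<close> makes the
      \<open>P\<close>-th powers add up to \<open>t / t\<close>. Cutting off at \<open>m\<close>
      keeps \<open>y\<close> in the ball even when \<open>a\<close> has infinite norm.\<close>
    define y where "y k = (if k < m then \<bar>a k\<bar> powr (Q - 1) / t powr (1 / P) else 0)" for k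
    have yP: "\<bar>y k\<bar> powr P = (if k < m then \<bar>a k\<bar> powr Q / t else 0)" for k
      using assms t PQ by (simp add: y_def powr_divide powr_powr mult.commute)
    have "(\<Sum>k<n. \<bar>y k\<bar> powr P) \<le> 1" for n
    proof -
      have "(\<Sum>k<n. \<bar>y k\<bar> powr P) = (\<Sum>k\<in>{..<n} \<inter> {..<m}. \<bar>a k\<bar> powr Q / t)"
        unfolding yP by (subst sum.inter_restrict) auto
      also have "\<dots> \<le> (\<Sum>k<m. \<bar>a k\<bar> powr Q / t)"
        using t by (intro sum_mono2) auto
      also have "\<dots> = 1"
        using t by (simp add: t_def flip: sum_divide_distrib)
      finally show ?thesis .
    qed
    then have "y \<in> unit_ball (ennreal P)"
      using assms lp_norm_le_iff[of P 1 y] by (simp add: unit_ball_def)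
    then have "pairing a y \<le> ennreal s"
      unfolding real(2)[symmetric] by (rule SUP_upper)
    then have "(\<Sum>k<m. \<bar>a k * y k\<bar>) \<le> s"
      using real by (simp add: pairing_le_iff)
    also have "(\<Sum>k<m. \<bar>a k * y k\<bar>) = (\<Sum>k<m. \<bar>a k\<bar> powr Q / t powr (1 / P))"
    proof (intro sum.cong)
      fix k assume "k \<in> {..<m}"
      then show "\<bar>a k * y k\<bar> = \<bar>a k\<bar> powr Q / t powr (1 / P)"
        using powr_mult_base[of "\<bar>a k\<bar>" "Q - 1"] by (simp add: y_def abs_mult)
    qed simp
    also have "\<dots> = t powr 1 / t powr (1 / P)"
      using t by (simp add: t_def flip: sum_divide_distrib)
    also have "\<dots> = t powr (1 / Q)"
      unfolding powr_diff[symmetric] PQ ..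
    finally have "(t powr (1 / Q)) powr Q \<le> s powr Q"
      using assms by (intro powr_mono2) auto
    then show ?thesis
      using assms t by (simp add: powr_powr t_def)
  qed auto
  then show ?thesis
    unfolding real(2) using real assms by (simp add: lp_norm_le_iff)
qed (simp only: top_greatest)

text \<open>The test vectors are unit vectors for \<open>p = 1\<close>, the constant 1 for
  \<open>p = \<infinity>\<close>, and truncated powers of \<open>a\<close> otherwise. Both sides may
  be infinite, which is the case that \<open>in_dual_if_summable\<close> exploits.\<close>

theorem lp_norm_dual:
  assumes "conjugate_exponents p q" "1 \<le> p"
  shows "lp_norm q a = (SUP y\<in>unit_ball p. pairing a y)"
  using assms
proof (cases rule: conjugate_cases)
  case 1
  show ?thesis unfolding 1
  proof (intro antisym SUP_least)
    fix y assume y: "y \<in> unit_ball 1"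
    have "pairing a y \<le> (\<Sum>k. lp_norm \<infinity> a * ennreal \<bar>y k\<bar>)"
      unfolding pairing_def lp_norm_infinity
      by (intro suminf_le) (auto simp: abs_mult ennreal_mult intro!: mult_right_mono SUP_upper)
    also have "\<dots> = lp_norm \<infinity> a * lp_norm 1 y"
      by (simp add: lp_norm_1)
    also have "\<dots> \<le> lp_norm \<infinity> a * 1"
      using y by (intro mult_left_mono) (auto simp: unit_ball_def)
    finally show "pairing a y \<le> lp_norm \<infinity> a" by simp
  next
    have "ennreal \<bar>a k\<bar> \<le> (SUP y\<in>unit_ball 1. pairing a y)" for k
    proof (rule SUP_upper2)
      define e :: rseq where "e j = (if j = k then 1 else 0)" for j
      have "(\<Sum>j. ennreal \<bar>e j\<bar>) = (\<Sum>j\<in>{k}. ennreal \<bar>e j\<bar>)"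
        by (rule suminf_finite) (auto simp: e_def)
      then show "e \<in> unit_ball 1"
        by (simp add: unit_ball_def lp_norm_1 e_def)
      have "pairing a e = (\<Sum>j\<in>{k}. ennreal \<bar>a j * e j\<bar>)"
        unfolding pairing_def by (rule suminf_finite) (auto simp: e_def)
      then show "ennreal \<bar>a k\<bar> \<le> pairing a e"
        by (simp add: e_def)
    qed
    then show "lp_norm \<infinity> a \<le> (SUP y\<in>unit_ball 1. pairing a y)"
      unfolding lp_norm_infinity SUP_le_iff by blast
  qed
next
  case 2
  show ?thesis unfolding 2
  proof (intro antisym SUP_least)
    fix y assume "y \<in> unit_ball \<infinity>"
    then have "\<bar>y k\<bar> \<le> 1" for k
      by (simp add: unit_ball_def lp_norm_infinity[simplified] SUP_le_iff)
    then show "pairing a y \<le> lp_norm 1 a"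
      unfolding pairing_def lp_norm_1
      by (intro suminf_le) (auto simp: abs_mult intro!: ennreal_leI mult_left_le)
  next
    show "lp_norm 1 a \<le> (SUP y\<in>unit_ball \<infinity>. pairing a y)"
      by (rule SUP_upper2[of "\<lambda>_. 1"]) (auto simp: unit_ball_def lp_norm_infinity[simplified] lp_norm_1 pairing_def)
  qed
next
  case (3 P Q)
  then show ?thesis
    by (auto intro!: antisym lp_norm_le_SUP_pairing SUP_least pairing_le_lp_norm)
qed

section \<open>Unit vectors and the arithmetic of the pairing\<close>

definition unit_vec :: "nat \<Rightarrow> rseq" where
  "unit_vec k j = of_bool (j = k)"

lemma lp_norm_unit_vec:
  assumes "conjugate_exponents p q" "1 \<le> p"
  shows "lp_norm p (unit_vec k) \<le> 1"
  using assms
proof (cases rule: conjugate_cases)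
  case 1
  have "(\<Sum>j. ennreal \<bar>unit_vec k j\<bar>) = (\<Sum>j\<in>{k}. ennreal \<bar>unit_vec k j\<bar>)"
    by (rule suminf_finite) (auto simp: unit_vec_def)
  then show ?thesis
    using 1 by (simp add: lp_norm_1 unit_vec_def)
next
  case 2
  then show ?thesis
    by (auto simp: lp_norm_infinity[simplified] SUP_le_iff unit_vec_def)
next
  case (3 P Q)
  have "(\<Sum>j<m. \<bar>unit_vec k j\<bar> powr P) \<le> 1" for m
  proof -
    have "(\<Sum>j<m. \<bar>unit_vec k j\<bar> powr P) = (\<Sum>j<m. if j = k then 1 else 0)"
      using 3 by (intro sum.cong) (auto simp: unit_vec_def)
    then show ?thesis by simp
  qed
  then show ?thesis
    using 3 lp_norm_le_iff[of P 1 "unit_vec k"] by simp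
qed

lemma pairing_unit_vec: "pairing a (unit_vec k) = ennreal \<bar>a k\<bar>"
proof -
  have "pairing a (unit_vec k) = (\<Sum>j\<in>{k}. ennreal \<bar>a j * unit_vec k j\<bar>)"
    unfolding pairing_def by (rule suminf_finite) (auto simp: unit_vec_def)
  then show ?thesis by (simp add: unit_vec_def)
qed

lemma pairing_commute: "pairing a y = pairing y a"
  by (simp add: pairing_def mult.commute)

lemma pairing_scale: "pairing (\<lambda>k. c * a k) y = ennreal \<bar>c\<bar> * pairing a y"
  by (simp add: pairing_def abs_mult ennreal_mult mult.assoc)

lemma pairing_add: "pairing (\<lambda>k. a k + b k) y \<le> pairing a y + pairing b y"
proof -
  have "pairing (\<lambda>k. a k + b k) y \<le> (\<Sum>k. ennreal \<bar>a k * y k\<bar> + ennreal \<bar>b k * y k\<bar>)"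
    unfolding pairing_def
    by (intro suminf_le) (auto simp: distrib_right simp flip: ennreal_plus intro!: ennreal_leI)
  then show ?thesis
    by (simp add: pairing_def suminf_add)
qed

lemma pairing_mono: "(\<And>k. \<bar>a k\<bar> \<le> \<bar>b k\<bar>) \<Longrightarrow> pairing a y \<le> pairing b y"
  unfolding pairing_def
  by (intro suminf_le) (auto simp: abs_mult intro!: ennreal_leI mult_right_mono)

lemma summable_iff_pairing: "summable (\<lambda>k. \<bar>a k * y k\<bar>) \<longleftrightarrow> pairing a y < \<infinity>"
  using summable_suminf_not_top[of "\<lambda>k. \<bar>a k * y k\<bar>"]
    ennreal_suminf_neq_top[of "\<lambda>k. \<bar>a k * y k\<bar>"]
  by (auto simp: pairing_def top.not_eq_extremum)

lemma suminf_le_pairing: "ennreal \<bar>\<Sum>k. a k * y k\<bar> \<le> pairing a y"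
proof (cases "pairing a y < \<infinity>")
  case True
  then have sm: "summable (\<lambda>k. \<bar>a k * y k\<bar>)"
    by (simp add: summable_iff_pairing)
  then show ?thesis
    unfolding pairing_def by (subst suminf_ennreal2) (auto intro!: ennreal_leI summable_rabs)
qed (simp add: not_less top_unique)

text \<open>Below every positive \<open>ennreal\<close> lies a positive real, so real bounds decide
  convergence to 0.\<close>

lemma tendsto_0_iff_ennreal:
  "(f \<longlongrightarrow> (0::ennreal)) F \<longleftrightarrow> (\<forall>e>0. \<forall>\<^sub>F i in F. f i \<le> ennreal e)"
proof
  assume "(f \<longlongrightarrow> 0) F"
  then show "\<forall>e>0. \<forall>\<^sub>F i in F. f i \<le> ennreal e"
    by (auto dest: order_tendstoD(2)[of _ _ _ "ennreal _"] elim!: eventually_mono)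
next
  assume le: "\<forall>e>0. \<forall>\<^sub>F i in F. f i \<le> ennreal e"
  show "(f \<longlongrightarrow> 0) F"
  proof (rule order_tendstoI)
    fix a :: ennreal assume "0 < a"
    then obtain b where b: "0 < b" "b < a"
      using dense by blast
    then obtain e where e: "b = ennreal e" "0 < e"
      by (cases b) auto
    with le have "\<forall>\<^sub>F i in F. f i \<le> b"
      by auto
    then show "\<forall>\<^sub>F i in F. f i < a"
      by eventually_elim (use b in auto)
  qed auto
qed

text \<open>Through \<open>conj_swap\<close> each fact below is also available for the dual
  exponent; the pairs \<open>(1, \<infinity>)\<close> and \<open>(\<infinity>, 1)\<close> supply the
  norms of the target spaces.\<close>

locale conjugate_pair =
  fixes p q :: ennreal
  assumes conj: "conjugate_exponents p q" and ge_1: "1 \<le> p"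
begin

lemma conj_swap: "conjugate_pair q p"
  using conj conjugate_exponents_ge_1 by unfold_locales (auto intro: conjugate_exponents_sym)

text \<open>The norm laws that follow are read off from this formula, since each is evident for
  \<open>pairing\<close> with a fixed second argument; the case distinction on \<open>p\<close> does
  not recur.\<close>

lemma dual_norm: "lp_norm p x = (SUP y\<in>unit_ball q. pairing x y)"
  using conj_swap lp_norm_dual by (simp add: conjugate_pair_def)

lemma norm_zero: "lp_norm p (\<lambda>_. 0) = 0"
  by (auto simp: dual_norm pairing_def intro!: antisym SUP_least)

lemma norm_scale: "lp_norm p (\<lambda>k. c * x k) = ennreal \<bar>c\<bar> * lp_norm p x"
  unfolding dual_norm pairing_scale
  using norm_zero by (subst SUP_mult_left_ennreal) (auto simp: unit_ball_def)

lemma norm_triangle: "lp_norm p (\<lambda>k. x k + y k) \<le> lp_norm p x + lp_norm p y"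
  unfolding dual_norm
  by (intro SUP_least order_trans[OF pairing_add] add_mono SUP_upper)

lemma norm_diff: "lp_norm p (\<lambda>k. x k - y k) \<le> lp_norm p x + lp_norm p y"
  using norm_triangle[of x "\<lambda>k. - 1 * y k"] unfolding norm_scale by simp

lemma norm_mono: "(\<And>k. \<bar>x k\<bar> \<le> \<bar>y k\<bar>) \<Longrightarrow> lp_norm p x \<le> lp_norm p y"
  unfolding dual_norm by (intro SUP_mono) (blast intro: pairing_mono)

lemma coordinate_le_norm: "ennreal \<bar>x k\<bar> \<le> lp_norm p x"
  unfolding dual_norm pairing_unit_vec[symmetric]
  using conj_swap lp_norm_unit_vec
  by (intro SUP_upper) (auto simp: unit_ball_def conjugate_pair_def)

text \<open>A Fatou property: finite partial sums of the pairing are continuous in the coordinates,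
  and the norm is their supremum. It bounds vectors known only as coordinatewise limits.\<close>

lemma norm_lower_semicontinuous:
  assumes lim: "\<And>k. (\<lambda>i. x i k) \<longlonglongrightarrow> u k"
    and le: "\<forall>\<^sub>F i in sequentially. lp_norm p (x i) \<le> C"
  shows "lp_norm p u \<le> C"
proof (cases C)
  case (real c)
  show ?thesis unfolding dual_norm real(2)
  proof (intro SUP_least, subst pairing_le_iff[OF real(1)], intro allI)
    fix y m assume y: "y \<in> unit_ball q"
    have "(\<lambda>i. \<Sum>k<m. \<bar>x i k * y k\<bar>) \<longlonglongrightarrow> (\<Sum>k<m. \<bar>u k * y k\<bar>)"
      by (intro tendsto_intros lim)
    moreover have "\<forall>\<^sub>F i in sequentially. (\<Sum>k<m. \<bar>x i k * y k\<bar>) \<le> c"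
      using le
    proof eventually_elim
      case (elim i)
      have "pairing (x i) y \<le> lp_norm p (x i)"
        unfolding dual_norm using y by (rule SUP_upper)
      with elim show ?case
        using pairing_le_iff[OF real(1)] real(2) order_trans by metis
    qed
    ultimately show "(\<Sum>k<m. \<bar>u k * y k\<bar>) \<le> c"
      by (intro tendsto_upperbound) auto
  qed
qed simp

lemma unit_vec_in_ell: "unit_vec k \<in> ell p"
  using lp_norm_unit_vec[OF conj ge_1, of k] by (auto simp: ell_def intro: le_less_trans)

lemma ell_scale: "x \<in> ell p \<Longrightarrow> (\<lambda>k. c * x k) \<in> ell p"
  by (auto simp: ell_def norm_scale ennreal_mult_less_top)

lemma ell_add: "x \<in> ell p \<Longrightarrow> y \<in> ell p \<Longrightarrow> (\<lambda>k. x k + y k) \<in> ell p"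
  using norm_triangle[of x y] by (auto simp: ell_def intro: le_less_trans)

lemma ell_diff: "x \<in> ell p \<Longrightarrow> y \<in> ell p \<Longrightarrow> (\<lambda>k. x k - y k) \<in> ell p"
  using norm_diff[of x y] by (auto simp: ell_def intro: le_less_trans)

lemma ell_mono: "y \<in> ell p \<Longrightarrow> (\<And>k. \<bar>x k\<bar> \<le> \<bar>y k\<bar>) \<Longrightarrow> x \<in> ell p"
  using norm_mono[of x y] by (auto simp: ell_def intro: le_less_trans)

lemma unit_ball_subset: "unit_ball p \<subseteq> ell p"
  by (auto simp: unit_ball_def ell_def intro: le_less_trans)

lemma scale_into_unit_ball:
  assumes "0 < B" "lp_norm p y \<le> ennreal B"
  shows "(\<lambda>k. (1 / B) * y k) \<in> unit_ball p"
proof -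
  have "lp_norm p (\<lambda>k. (1 / B) * y k) \<le> ennreal (1 / B) * ennreal B"
    unfolding norm_scale using assms by (intro mult_mono) auto
  then show ?thesis
    using assms by (simp add: unit_ball_def flip: ennreal_mult)
qed

lemma Holder:
  assumes "0 < B" "lp_norm p y \<le> ennreal B"
  shows "pairing a y \<le> ennreal B * lp_norm q a"
proof -
  have "pairing a y = ennreal B * pairing a (\<lambda>k. (1 / B) * y k)"
    using assms unfolding pairing_commute[of a] pairing_scale
    by (simp add: mult.assoc[symmetric] flip: ennreal_mult)
  also have "\<dots> \<le> ennreal B * lp_norm q a"
    using scale_into_unit_ball[OF assms] unfolding lp_norm_dual[OF conj ge_1]
    by (intro mult_left_mono SUP_upper) auto
  finally show ?thesis .
qed

lemma ell_bounded:
  assumes "y \<in> ell p"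
  obtains B where "0 < B" "lp_norm p y \<le> ennreal B"
proof (cases "lp_norm p y")
  case (real r)
  then show ?thesis
    by (intro that[of "r + 1"]) (auto intro: ennreal_leI)
qed (use assms in \<open>simp add: ell_def\<close>)

lemma summable_product:
  assumes "a \<in> ell q" "y \<in> ell p"
  shows "summable (\<lambda>k. \<bar>a k * y k\<bar>)"
proof -
  obtain B where "0 < B" "lp_norm p y \<le> ennreal B"
    using assms(2) by (rule ell_bounded)
  then have "pairing a y \<le> ennreal B * lp_norm q a"
    by (rule Holder)
  also have "\<dots> < \<infinity>"
    using assms(1) by (simp add: ell_def ennreal_mult_less_top)
  finally show ?thesis
    by (simp add: summable_iff_pairing)
qed

text \<open>The signs of \<open>a\<close> can be moved into \<open>y\<close> without enlarging its
  norm. Membership in \<open>ell q\<close> makes the series converge, so that its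
  \<open>suminf\<close> is a genuine sum.\<close>

lemma dual_norm_signed:
  assumes a: "a \<in> ell q"
  shows "lp_norm q a = (SUP y\<in>unit_ball p. ennreal \<bar>\<Sum>k. a k * y k\<bar>)"
  unfolding lp_norm_dual[OF conj ge_1]
proof (intro antisym SUP_mono)
  fix y assume y: "y \<in> unit_ball p"
  define z where "z k = sgn (a k) * \<bar>y k\<bar>" for k
  have az: "a k * z k = \<bar>a k * y k\<bar>" for k
    by (auto simp: z_def abs_mult sgn_if)
  have "lp_norm p z \<le> lp_norm p y"
    by (rule norm_mono) (auto simp: z_def abs_mult sgn_if)
  then have "z \<in> unit_ball p"
    using y by (auto simp: unit_ball_def)
  moreover have "summable (\<lambda>k. \<bar>a k * y k\<bar>)"
    using a y unit_ball_subset by (intro summable_product) auto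
  then have "pairing a y = ennreal \<bar>\<Sum>k. a k * z k\<bar>"
    unfolding az pairing_def by (subst suminf_ennreal2) (auto simp: suminf_nonneg)
  ultimately show "\<exists>z\<in>unit_ball p. pairing a y \<le> ennreal \<bar>\<Sum>k. a k * z k\<bar>"
    by auto
qed (use suminf_le_pairing in blast)

lemma norm_sum:
  assumes "finite I"
  shows "lp_norm p (\<lambda>k. \<Sum>i\<in>I. x i k) \<le> (\<Sum>i\<in>I. lp_norm p (x i))"
  using assms
proof induction
  case (insert i I)
  then show ?case
    using norm_triangle[of "x i" "\<lambda>k. \<Sum>i\<in>I. x i k"] by (auto intro: order_trans add_left_mono)
qed (simp add: norm_zero)

text \<open>A condensation argument: otherwise some vectors \<open>z n\<close> of the unit ball have
  pairings above \<open>4 ^ n\<close>; their superposition with weights \<open>(1 / 2) ^ n\<close>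
  stays in \<open>ell p\<close>, yet its pairing with \<open>a\<close> is at least
  \<open>2 ^ n\<close> for every \<open>n\<close>.\<close>

theorem in_dual_if_summable:
  assumes sm: "\<And>y. y \<in> ell p \<Longrightarrow> summable (\<lambda>k. a k * y k)"
  shows "a \<in> ell q"
proof (rule ccontr)
  assume "a \<notin> ell q"
  then have inf: "(SUP y\<in>unit_ball p. pairing a y) = \<infinity>"
    by (simp add: ell_def not_less top_unique flip: lp_norm_dual[OF conj ge_1])
  have "\<exists>y\<in>unit_ball p. ennreal (4 ^ n) < pairing a y" for n :: nat
    using inf by (subst less_SUP_iff[symmetric]) (simp only: infinity_ennreal_def ennreal_less_top)
  then obtain z where z: "\<And>n. z n \<in> unit_ball p" "\<And>n. ennreal (4 ^ n) < pairing a (z n)"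
    by metis
  have z1: "\<bar>z n k\<bar> \<le> 1" for n k
    using coordinate_le_norm[of "z n" k] z(1)[of n] by (simp add: unit_ball_def flip: ennreal_1)
       (metis ennreal_1 ennreal_le_1 order_trans)
  define x where "x k = (\<Sum>n. (1 / 2) ^ n * \<bar>z n k\<bar>)" for k
  have sx: "summable (\<lambda>n. (1 / 2) ^ n * \<bar>z n k\<bar>)" for k
    by (rule summable_comparison_test'[OF summable_geometric[of "1 / 2"], of 0])
      (auto simp: z1 mult_left_le)
  \<comment> \<open>\<open>x\<close> is known only as a coordinatewise limit of partial sums, whose
    norms are bounded by the geometric sum 2.\<close>
  have "lp_norm p x \<le> 2"
  proof (rule norm_lower_semicontinuous)
    show "(\<lambda>m. \<Sum>n<m. (1 / 2) ^ n * \<bar>z n k\<bar>) \<longlonglongrightarrow> x k" for k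
      unfolding x_def by (rule summable_LIMSEQ[OF sx])
    have "lp_norm p (\<lambda>k. \<Sum>n<m. (1 / 2) ^ n * \<bar>z n k\<bar>) \<le> 2" for m :: nat
    proof -
      have "lp_norm p (\<lambda>k. \<Sum>n<m. (1 / 2) ^ n * \<bar>z n k\<bar>)
          \<le> (\<Sum>n<m. ennreal \<bar>(1 / 2) ^ n\<bar> * lp_norm p (\<lambda>k. \<bar>z n k\<bar>))"
        by (rule order_trans[OF norm_sum]) (auto simp only: norm_scale finite_lessThan)
      also have "\<dots> \<le> (\<Sum>n<m. ennreal ((1 / 2) ^ n) * 1)"
      proof (intro sum_mono mult_mono)
        fix n
        have "lp_norm p (\<lambda>k. \<bar>z n k\<bar>) \<le> lp_norm p (z n)"
          by (rule norm_mono) simp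
        then show "lp_norm p (\<lambda>k. \<bar>z n k\<bar>) \<le> 1"
          using z(1)[of n] by (auto simp: unit_ball_def)
      qed auto
      also have "\<dots> = ennreal (\<Sum>n<m. (1 / 2) ^ n)"
        by (simp add: sum_ennreal)
      also have "\<dots> \<le> ennreal 2"
        by (intro ennreal_leI) (simp add: sum_gp_strict)
      finally show ?thesis by simp
    qed
    then show "\<forall>\<^sub>F m in sequentially. lp_norm p (\<lambda>k. \<Sum>n<m. (1 / 2) ^ n * \<bar>z n k\<bar>) \<le> 2"
      by simp
  qed
  then have "x \<in> ell p"
    by (auto simp: ell_def intro: le_less_trans)
  \<comment> \<open>The hypothesis gives conditional convergence only; putting the signs of
    \<open>a\<close> into the test vector makes it absolute.\<close>
  then have "(\<lambda>k. sgn (a k) * x k) \<in> ell p"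
    by (rule ell_mono) (auto simp: abs_mult sgn_if)
  then have "summable (\<lambda>k. a k * (sgn (a k) * x k))"
    by (rule sm)
  moreover have x0: "0 \<le> x k" for k
    unfolding x_def by (intro suminf_nonneg sx) auto
  ultimately have S: "summable (\<lambda>k. \<bar>a k\<bar> * x k)"
    by (simp add: mult.assoc[symmetric] abs_sgn)
  define s where "s = (\<Sum>k. \<bar>a k\<bar> * x k)"
  have "2 ^ n \<le> s" for n
  proof -
    have "\<not> pairing a (z n) \<le> ennreal (4 ^ n)"
      using z(2) by (simp add: not_le)
    then obtain m where m: "4 ^ n < (\<Sum>k<m. \<bar>a k * z n k\<bar>)"
      by (auto simp: pairing_le_iff not_le)
    have "2 ^ n = (1 / 2) ^ n * (4::real) ^ n"
      by (simp flip: power_mult_distrib)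
    also have "\<dots> \<le> (1 / 2) ^ n * (\<Sum>k<m. \<bar>a k * z n k\<bar>)"
      using m by (intro mult_left_mono) auto
    also have "\<dots> = (\<Sum>k<m. \<bar>a k\<bar> * ((1 / 2) ^ n * \<bar>z n k\<bar>))"
      by (simp add: sum_distrib_left abs_mult algebra_simps)
    also have "\<dots> \<le> (\<Sum>k<m. \<bar>a k\<bar> * x k)"
    proof (intro sum_mono mult_left_mono)
      fix k
      show "(1 / 2) ^ n * \<bar>z n k\<bar> \<le> x k"
        using sum_le_suminf[OF sx[of k], of "{n}"] by (simp add: x_def)
    qed simp
    also have "\<dots> \<le> s"
      unfolding s_def using x0 by (intro sum_le_suminf S) auto
    finally show ?thesis .
  qed
  moreover obtain n where "s < 2 ^ n"
    using real_arch_pow[of 2 s] by auto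
  ultimately show False
    by (meson not_le)
qed

text \<open>Completeness: the norm dominates coordinates, so a coordinatewise limit exists, and
  lower semicontinuity in \<open>j\<close> turns the Cauchy bound into a distance to it. Membership
  of \<open>u\<close> in a space is left to \<open>ell_limit\<close> or to the closedness assumption
  of \<open>tail_space\<close>.\<close>

lemma norm_Cauchy_limit:
  assumes Cauchy: "\<And>e. 0 < e \<Longrightarrow> \<exists>M. \<forall>i\<ge>M. \<forall>j\<ge>M. lp_norm p (\<lambda>k. v i k - v j k) \<le> ennreal e"
  obtains u where "(\<lambda>i. lp_norm p (\<lambda>k. v i k - u k)) \<longlonglongrightarrow> 0"
proof -
  have "Cauchy (\<lambda>i. v i k)" for k
  proof (rule metric_CauchyI)
    fix e :: real assume "0 < e"
    then obtain M where M: "\<forall>i\<ge>M. \<forall>j\<ge>M. lp_norm p (\<lambda>k. v i k - v j k) \<le> ennreal (e / 2)"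
      using Cauchy[of "e / 2"] by auto
    have "dist (v i k) (v j k) < e" if "M \<le> i" "M \<le> j" for i j
    proof -
      have "ennreal \<bar>v i k - v j k\<bar> \<le> ennreal (e / 2)"
        using that M coordinate_le_norm[of "\<lambda>k. v i k - v j k" k] order_trans by blast
      then show ?thesis
        using \<open>0 < e\<close> by (simp add: dist_real_def)
    qed
    then show "\<exists>M. \<forall>i\<ge>M. \<forall>j\<ge>M. dist (v i k) (v j k) < e"
      by blast
  qed
  then have lim: "(\<lambda>i. v i k) \<longlonglongrightarrow> lim (\<lambda>i. v i k)" for k
    by (simp add: Cauchy_convergent_iff convergent_LIMSEQ_iff)
  define u where "u k = lim (\<lambda>i. v i k)" for k
  have "(\<lambda>i. lp_norm p (\<lambda>k. v i k - u k)) \<longlonglongrightarrow> 0"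
    unfolding tendsto_0_iff_ennreal
  proof (intro allI impI)
    fix e :: real assume "0 < e"
    then obtain M where M: "\<forall>i\<ge>M. \<forall>j\<ge>M. lp_norm p (\<lambda>k. v i k - v j k) \<le> ennreal e"
      using Cauchy by blast
    have "lp_norm p (\<lambda>k. v i k - u k) \<le> ennreal e" if "M \<le> i" for i
    proof (rule norm_lower_semicontinuous)
      show "(\<lambda>j. v i k - v j k) \<longlonglongrightarrow> v i k - u k" for k
        unfolding u_def by (intro tendsto_intros lim)
      show "\<forall>\<^sub>F j in sequentially. lp_norm p (\<lambda>k. v i k - v j k) \<le> ennreal e"
        using M that by (auto simp: eventually_sequentially)
    qed
    then show "\<forall>\<^sub>F i in sequentially. lp_norm p (\<lambda>k. v i k - u k) \<le> ennreal e"
      by (auto simp: eventually_sequentially)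
  qed
  then show thesis by (rule that)
qed

lemma ell_limit:
  assumes v: "\<And>i. v i \<in> ell p" and lim: "(\<lambda>i. lp_norm p (\<lambda>k. v i k - u k)) \<longlonglongrightarrow> 0"
  shows "u \<in> ell p"
proof -
  obtain i where "lp_norm p (\<lambda>k. v i k - u k) < 1"
    using order_tendstoD(2)[OF lim, of 1] by (auto simp: eventually_sequentially)
  then have "(\<lambda>k. v i k - u k) \<in> ell p"
    by (auto simp: ell_def intro: less_trans)
  then show ?thesis
    using ell_diff[OF v[of i], of "\<lambda>k. v i k - u k"] by simp
qed

lemma coordinate_limit:
  assumes lim: "(\<lambda>i. lp_norm p (\<lambda>k. v i k - u k)) \<longlonglongrightarrow> 0"
  shows "(\<lambda>i. v i k) \<longlonglongrightarrow> u k"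
proof -
  have "(\<lambda>i. ennreal \<bar>v i k - u k\<bar>) \<longlonglongrightarrow> 0"
    by (rule tendsto_sandwich[OF _ _ tendsto_const lim])
      (auto intro!: always_eventually coordinate_le_norm[of "\<lambda>k. v _ k - u k"])
  then have "(\<lambda>i. \<bar>v i k - u k\<bar>) \<longlonglongrightarrow> 0"
    by (subst (asm) ennreal_0[symmetric], subst (asm) tendsto_ennreal_iff) auto
  then show ?thesis
    by (simp add: tendsto_rabs_zero_iff LIM_zero_iff)
qed

end

interpretation one: conjugate_pair 1 \<infinity>
  by unfold_locales (auto simp: conjugate_exponents_1)

interpretation infty: conjugate_pair \<infinity> 1
  by (rule one.conj_swap)

subsection \<open>Schur's theorem\<close>

lemma ell_1_iff: "x \<in> ell 1 \<longleftrightarrow> summable (\<lambda>k. \<bar>x k\<bar>)"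
  using summable_iff_pairing[of x "\<lambda>_. 1"] by (simp add: ell_def lp_norm_1 pairing_def)

lemma lp_norm_1_summable: "summable (\<lambda>k. \<bar>x k\<bar>) \<Longrightarrow> lp_norm 1 x = ennreal (\<Sum>k. \<bar>x k\<bar>)"
  by (simp add: lp_norm_1 suminf_ennreal2)

text \<open>A gliding hump: if the norms did not tend to \<open>0\<close>, one could choose rows and disjoint blocks
  such that each row carries almost all of its mass on its block, and then glue the signs of the
  rows on their blocks to a single test sequence.\<close>

lemma Schur:
  fixes psi :: matrix
  assumes sm: "\<And>i. summable (\<lambda>k. \<bar>psi i k\<bar>)"
    and weak: "\<And>z. (\<And>k. \<bar>z k\<bar> \<le> 1) \<Longrightarrow> (\<lambda>i. \<Sum>k. psi i k * z k) \<longlonglongrightarrow> 0"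
  shows "(\<lambda>i. \<Sum>k. \<bar>psi i k\<bar>) \<longlonglongrightarrow> 0"
proof (rule ccontr)
  define S where "S i = (\<Sum>k. \<bar>psi i k\<bar>)" for i
  have S0: "0 \<le> S i" for i
    unfolding S_def by (rule suminf_nonneg[OF sm]) simp
  assume "\<not> (\<lambda>i. \<Sum>k. \<bar>psi i k\<bar>) \<longlonglongrightarrow> 0"
  then have "\<not> S \<longlonglongrightarrow> 0"
    by (simp add: S_def[abs_def])
  then obtain e where e: "0 < e" "\<And>N. \<exists>i\<ge>N. e \<le> S i"
    unfolding lim_sequentially using S0 by (auto simp: not_less)
  \<comment> \<open>Testing against unit vectors shows that any fixed initial block becomes
    negligible in late rows.\<close>
  have coord: "(\<lambda>i. psi i k) \<longlonglongrightarrow> 0" for k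
  proof -
    have "(\<Sum>j. psi i j * unit_vec k j) = (\<Sum>j\<in>{k}. psi i j * unit_vec k j)" for i
      by (rule suminf_finite) (auto simp: unit_vec_def)
    then show ?thesis
      using weak[of "unit_vec k"] by (simp add: unit_vec_def)
  qed
  \<comment> \<open>The mass outside the block is at most \<open>2 * e / 5\<close>, and it is lost
    twice: as missing from the block and as a possible negative contribution. Of a total of at least
    \<open>e\<close>, one fifth of \<open>e\<close> remains.\<close>
  have step: "\<exists>i K'. I < i \<and> K < K' \<and> (\<Sum>k<K. \<bar>psi i k\<bar>) \<le> e / 5 \<and> S i - e / 5 \<le> (\<Sum>k<K'. \<bar>psi i k\<bar>) \<and> e \<le> S i"
    for I K
  proof -
    have "(\<lambda>i. \<Sum>k<K. \<bar>psi i k\<bar>) \<longlonglongrightarrow> (\<Sum>k<K. \<bar>0\<bar>)"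
      by (intro tendsto_intros coord)
    then have "\<forall>\<^sub>F i in sequentially. (\<Sum>k<K. \<bar>psi i k\<bar>) < e / 5"
      using e(1) by (intro order_tendstoD) auto
    then obtain N where N: "\<And>i. N \<le> i \<Longrightarrow> (\<Sum>k<K. \<bar>psi i k\<bar>) < e / 5"
      by (auto simp: eventually_sequentially)
    obtain i where i: "max N (Suc I) \<le> i" "e \<le> S i"
      using e(2) by blast
    have "(\<lambda>K'. \<Sum>k<K'. \<bar>psi i k\<bar>) \<longlonglongrightarrow> S i"
      unfolding S_def by (rule summable_LIMSEQ[OF sm])
    then have "\<forall>\<^sub>F K' in sequentially. S i - e / 5 < (\<Sum>k<K'. \<bar>psi i k\<bar>)"
      using e(1) by (intro order_tendstoD) auto
    then obtain M where M: "\<And>K'. M \<le> K' \<Longrightarrow> S i - e / 5 < (\<Sum>k<K'. \<bar>psi i k\<bar>)"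
      by (auto simp: eventually_sequentially)
    show ?thesis
      using i N[of i] M[of "max M (Suc K)"]
      by (intro exI[of _ i] exI[of _ "max M (Suc K)"]) (auto intro: less_imp_le)
  qed
  \<comment> \<open>The state is the last row used with the end of its block; \<open>True\<close>
    fills the invariant slot of the choice rule.\<close>
  have "\<exists>f. \<forall>n. True \<and> (case (f n, f (Suc n)) of ((I, K), (i, K')) \<Rightarrow>
      I < i \<and> K < K' \<and> (\<Sum>k<K. \<bar>psi i k\<bar>) \<le> e / 5 \<and> S i - e / 5 \<le> (\<Sum>k<K'. \<bar>psi i k\<bar>) \<and> e \<le> S i)"
    by (rule dependent_nat_choice) (use step in auto)
  then obtain f where f: "\<And>n. case (f n, f (Suc n)) of ((I, K), (i, K')) \<Rightarrow>
      I < i \<and> K < K' \<and> (\<Sum>k<K. \<bar>psi i k\<bar>) \<le> e / 5 \<and> S i - e / 5 \<le> (\<Sum>k<K'. \<bar>psi i k\<bar>) \<and> e \<le> S i"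
    by auto
  define I K where "I n = fst (f n)" and "K n = snd (f n)" for n
  have fn: "I n < I (Suc n)" "K n < K (Suc n)" "(\<Sum>k<K n. \<bar>psi (I (Suc n)) k\<bar>) \<le> e / 5"
      "S (I (Suc n)) - e / 5 \<le> (\<Sum>k<K (Suc n). \<bar>psi (I (Suc n)) k\<bar>)" "e \<le> S (I (Suc n))" for n
    using f[of n] by (auto simp: I_def K_def split: prod.splits)
  have mono: "strict_mono I" "strict_mono K"
    using fn by (auto simp: strict_mono_Suc_iff)
  \<comment> \<open>For \<open>k\<close> from \<open>K n\<close> up to \<open>K (Suc n)\<close> the
    \<open>LEAST\<close> is \<open>Suc n\<close>, the index of the row whose block this is. Below
    \<open>K 0\<close> it is 0; the signs there are arbitrary and absorbed by the head
    estimate.\<close>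
  define z where "z k = sgn (psi (I (LEAST n. k < K n)) k)" for k
  have z1: "\<bar>z k\<bar> \<le> 1" for k
    by (simp add: z_def abs_sgn_eq)
  have zmid: "z k = sgn (psi (I (Suc n)) k)" if "k \<in> {K n..<K (Suc n)}" for n k
  proof -
    have "(LEAST n. k < K n) = Suc n"
    proof (rule Least_equality)
      fix m assume "k < K m"
      then have "K n < K m"
        using that by auto
      then show "Suc n \<le> m"
        using mono(2) by (simp add: strict_mono_less Suc_le_eq)
    qed (use that in auto)
    then show ?thesis by (simp add: z_def)
  qed
  have low: "e / 5 \<le> (\<Sum>k. psi (I (Suc n)) k * z k)" for n
  proof -
    define x where "x = psi (I (Suc n))"
    define J where "J = {K n..<K (Suc n)}"
    have smx: "summable (\<lambda>k. \<bar>x k\<bar>)"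
      by (simp add: x_def sm)
    have le: "\<bar>x k * z k\<bar> \<le> \<bar>x k\<bar>" for k
      using z1 by (simp add: abs_mult mult_left_le)
    have smz: "summable (\<lambda>k. x k * z k)"
      by (rule summable_comparison_test'[OF smx, of 0]) (use le in auto)
    \<comment> \<open>Termwise comparison: \<open>\<bar>x k\<bar> - x k * z k\<close> vanishes on
      \<open>J\<close>, where \<open>z\<close> carries the signs of the row, and is at most
      \<open>2 * \<bar>x k\<bar>\<close> elsewhere.\<close>
    have "(\<lambda>k. \<bar>x k\<bar> - x k * z k) sums ((\<Sum>k. \<bar>x k\<bar>) - (\<Sum>k. x k * z k))"
      by (intro sums_diff summable_sums smx smz)
    moreover have "(\<lambda>k. 2 * \<bar>x k\<bar> - (if k \<in> J then 2 * \<bar>x k\<bar> else 0)) sums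
        (2 * (\<Sum>k. \<bar>x k\<bar>) - (\<Sum>k\<in>J. 2 * \<bar>x k\<bar>))"
      by (intro sums_diff sums_mult summable_sums smx sums_If_finite_set) (simp add: J_def)
    moreover have "\<bar>x k\<bar> - x k * z k \<le> 2 * \<bar>x k\<bar> - (if k \<in> J then 2 * \<bar>x k\<bar> else 0)" for k
    proof (cases "k \<in> J")
      case True
      then show ?thesis
        using zmid[of k n] by (simp add: J_def x_def abs_sgn)
    qed (use le[of k] in auto)
    ultimately have "(\<Sum>k. \<bar>x k\<bar>) - (\<Sum>k. x k * z k) \<le> 2 * (\<Sum>k. \<bar>x k\<bar>) - (\<Sum>k\<in>J. 2 * \<bar>x k\<bar>)"
      by (rule sums_le[rotated 1])
    moreover have "(\<Sum>k<K (Suc n). \<bar>x k\<bar>) = (\<Sum>k<K n. \<bar>x k\<bar>) + (\<Sum>k\<in>J. \<bar>x k\<bar>)"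
      using fn(2)[of n] sum.atLeastLessThan_concat[of 0 "K n" "K (Suc n)" "\<lambda>k. \<bar>x k\<bar>"]
      by (simp add: J_def lessThan_atLeast0)
    moreover have "(\<Sum>k\<in>J. 2 * \<bar>x k\<bar>) = 2 * (\<Sum>k\<in>J. \<bar>x k\<bar>)"
      by (simp add: sum_distrib_left)
    ultimately show ?thesis
      using fn(3-5)[of n] unfolding S_def x_def[symmetric] by argo
  qed
  have "(\<lambda>n. \<Sum>k. psi (I (Suc n)) k * z k) \<longlonglongrightarrow> 0"
    using LIMSEQ_subseq_LIMSEQ[OF weak[of z] mono(1), OF z1] LIMSEQ_Suc by (fastforce simp: o_def)
  then have "e / 5 \<le> 0"
    by (rule LIMSEQ_le_const) (use low in auto)
  then show False
    using e(1) by simp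
qed

text \<open>No weak limit is given in advance. If the rows were not Cauchy, differences of rows with
  arbitrarily large indices would tend weakly to 0 without becoming small in norm, against
  \<open>Schur\<close>; completeness then supplies \<open>u\<close>.\<close>

theorem weakly_convergent_imp_norm_convergent:
  fixes phi :: matrix
  assumes sm: "\<And>m. summable (\<lambda>k. \<bar>phi m k\<bar>)"
    and weak: "\<And>z. (\<And>k. \<bar>z k\<bar> \<le> 1) \<Longrightarrow> convergent (\<lambda>m. \<Sum>k. phi m k * z k)"
  obtains u where "(\<lambda>m. lp_norm 1 (\<lambda>k. phi m k - u k)) \<longlonglongrightarrow> 0"
proof (rule one.norm_Cauchy_limit)
  fix e :: real assume e: "0 < e"
  show "\<exists>M. \<forall>i\<ge>M. \<forall>j\<ge>M. lp_norm 1 (\<lambda>k. phi i k - phi j k) \<le> ennreal e"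
  proof (rule ccontr)
    assume "\<not> ?thesis"
    then have "\<exists>i j. M \<le> i \<and> M \<le> j \<and> \<not> lp_norm 1 (\<lambda>k. phi i k - phi j k) \<le> ennreal e" for M
      by blast
    then obtain i j where ij: "\<And>M. M \<le> i M" "\<And>M. M \<le> j M"
        "\<And>M. \<not> lp_norm 1 (\<lambda>k. phi (i M) k - phi (j M) k) \<le> ennreal e"
      by metis
    have top: "filterlim i at_top sequentially" "filterlim j at_top sequentially"
      using ij(1,2) by (auto intro!: filterlim_at_top_mono[OF filterlim_ident])
    define psi where "psi M k = phi (i M) k - phi (j M) k" for M k
    have smp: "summable (\<lambda>k. \<bar>psi M k\<bar>)" for M
      by (rule summable_comparison_test'[OF summable_add[OF sm[of "i M"] sm[of "j M"]], of 0])
        (auto simp: psi_def)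
    have "(\<lambda>M. \<Sum>k. \<bar>psi M k\<bar>) \<longlonglongrightarrow> 0"
    proof (rule Schur[OF smp])
      fix z :: rseq assume z: "\<And>k. \<bar>z k\<bar> \<le> 1"
      have smz: "summable (\<lambda>k. phi m k * z k)" for m
        by (rule summable_comparison_test'[OF sm[of m], of 0]) (auto simp: abs_mult z mult_left_le)
      obtain L where L: "(\<lambda>m. \<Sum>k. phi m k * z k) \<longlonglongrightarrow> L"
        using weak z by (auto simp: convergent_def)
      have "(\<lambda>M. (\<Sum>k. phi (i M) k * z k) - (\<Sum>k. phi (j M) k * z k)) \<longlonglongrightarrow> L - L"
        by (intro tendsto_diff filterlim_compose[OF L] top)
      then show "(\<lambda>M. \<Sum>k. psi M k * z k) \<longlonglongrightarrow> 0"
        by (simp add: psi_def left_diff_distrib suminf_diff smz)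
    qed
    then have "\<forall>\<^sub>F M in sequentially. (\<Sum>k. \<bar>psi M k\<bar>) < e"
      using e by (rule order_tendstoD)
    then obtain M where "(\<Sum>k. \<bar>psi M k\<bar>) < e"
      by (auto simp: eventually_sequentially)
    then have "lp_norm 1 (psi M) \<le> ennreal e"
      by (simp add: lp_norm_1_summable smp ennreal_leI)
    then show False
      using ij(3)[of M] by (simp add: psi_def[abs_def])
  qed
qed (rule that)

text \<open>Summation is continuous for the norm of \<open>ell 1\<close>; this performs the
  interchange of limit and sum once norm convergence is known.\<close>

lemma suminf_limit:
  assumes sm: "\<And>m. summable (\<lambda>k. \<bar>phi m k\<bar>)"
    and lim: "(\<lambda>m. lp_norm 1 (\<lambda>k. phi m k - u k)) \<longlonglongrightarrow> 0"
  shows "(\<lambda>m. \<Sum>k. phi m k) \<longlonglongrightarrow> (\<Sum>k. u k)"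
proof -
  have u: "u \<in> ell 1"
    using one.ell_limit[OF _ lim] sm by (simp add: ell_1_iff)
  have sd: "summable (\<lambda>k. \<bar>phi m k - u k\<bar>)" for m
    using one.ell_diff[OF _ u] sm by (simp add: ell_1_iff)
  have "(\<lambda>m. ennreal (\<Sum>k. \<bar>phi m k - u k\<bar>)) \<longlonglongrightarrow> ennreal 0"
    using lim by (simp add: lp_norm_1_summable sd)
  then have "(\<lambda>m. \<Sum>k. \<bar>phi m k - u k\<bar>) \<longlonglongrightarrow> 0"
    by (subst (asm) tendsto_ennreal_iff) (auto intro!: always_eventually suminf_nonneg sd)
  then have "(\<lambda>m. \<Sum>k. phi m k - u k) \<longlonglongrightarrow> 0"
    by (rule Lim_null_comparison[rotated]) (auto intro!: always_eventually summable_rabs sd)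
  then show ?thesis
    using sm u by (simp add: suminf_diff[symmetric] summable_rabs_cancel ell_1_iff LIM_zero_iff)
qed

subsection \<open>The inverse of \<open>E_seq\<close> and the matrix \<open>ahat\<close>\<close>

text \<open>The two reciprocals inside \<open>ahat\<close> are its values at \<open>k\<close> and
  \<open>k + 1\<close>.\<close>

definition weight :: "rseq \<Rightarrow> nat \<Rightarrow> real" where
  "weight lam k = 1 / ((lam k - prev lam k) * fibo k * fibo (k + 1))"

text \<open>Entries of the triangular matrix inverse to \<open>E_seq\<close>:
  \<open>lam j * y j\<close> enters the increment at \<open>j\<close> with
  \<open>weight lam j\<close> and the one at \<open>j + 1\<close> with a minus sign and the next
  weight; on the diagonal \<open>j = k\<close> the latter is absent.\<close>

definition E_inv_coeff :: "rseq \<Rightarrow> nat \<Rightarrow> nat \<Rightarrow> real" where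
  "E_inv_coeff lam k j = (fibo (k + 1))\<^sup>2 * lam j *
     (if j < k then weight lam j - weight lam (j + 1) else if j = k then weight lam j else 0)"

definition E_inv :: "rseq \<Rightarrow> rseq \<Rightarrow> rseq" where
  "E_inv lam y k = (\<Sum>j\<le>k. E_inv_coeff lam k j * y j)"

lemma prev_0 [simp]: "prev x 0 = 0" and prev_Suc [simp]: "prev x (Suc k) = x k"
  by (simp_all add: prev_def)

lemma fibo_pos: "0 < fibo k"
  by (simp add: fibo_def fib_neq_0_nat)

text \<open>Summation by parts, leading to the running sum of increments on which both inversion
  proofs rest.\<close>

lemma E_inv_eq:
  "E_inv lam y k =
     (fibo (k + 1))\<^sup>2 * (\<Sum>j\<le>k. weight lam j * (lam j * y j - prev (\<lambda>i. lam i * y i) j))"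
proof -
  have "(\<Sum>j\<le>k. weight lam j * (lam j * y j - prev (\<lambda>i. lam i * y i) j)) =
      (\<Sum>j<k. lam j * (weight lam j - weight lam (j + 1)) * y j) + lam k * weight lam k * y k"
    by (induction k) (auto simp: prev_def algebra_simps lessThan_Suc_atMost[symmetric])
  then show ?thesis
    by (simp add: E_inv_def E_inv_coeff_def lessThan_Suc_atMost[symmetric] sum_distrib_left algebra_simps)
qed

context
  fixes lam :: rseq
  assumes lam: "strict_mono lam" "\<And>k. 0 < lam k"
begin

lemma lam_diff_pos: "0 < lam k - prev lam k"
  using lam by (cases k) (auto simp: prev_def strict_mono_def)

lemma E_seq_E_inv: "E_seq lam (E_inv lam y) = y"
proof
  fix n
  define S where "S k = (\<Sum>j\<le>k. weight lam j * (lam j * y j - prev (\<lambda>i. lam i * y i) j))" for k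
  \<comment> \<open>The Fibonacci quotients reduce the squares in \<open>E_inv\<close> to
    \<open>fibo k * fibo (k + 1)\<close> times an increment of \<open>S\<close>;
    \<open>weight\<close> cancels this factor together with the increment of
    \<open>lam\<close>.\<close>
  have "(lam k - prev lam k) *
      (fibo k / fibo (k + 1) * E_inv lam y k - fibo (k + 1) / fibo k * prev (E_inv lam y) k)
      = lam k * y k - prev (\<lambda>i. lam i * y i) k" for k
  proof -
    have "fibo k / fibo (k + 1) * E_inv lam y k = fibo k * fibo (k + 1) * S k"
      using fibo_pos[of "k + 1"] unfolding E_inv_eq S_def[symmetric]
      by (simp add: power2_eq_square)
    moreover have "fibo (k + 1) / fibo k * prev (E_inv lam y) k = fibo k * fibo (k + 1) * prev S k"
      using fibo_pos[of k] by (cases k) (simp_all add: E_inv_eq S_def power2_eq_square)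
    moreover have "S k - prev S k = weight lam k * (lam k * y k - prev (\<lambda>i. lam i * y i) k)"
      by (cases k) (auto simp: S_def prev_def)
    ultimately have "fibo k / fibo (k + 1) * E_inv lam y k - fibo (k + 1) / fibo k * prev (E_inv lam y) k
        = fibo k * fibo (k + 1) * (weight lam k * (lam k * y k - prev (\<lambda>i. lam i * y i) k))"
      by (simp flip: right_diff_distrib)
    then show ?thesis
      using fibo_pos[of k] fibo_pos[of "k + 1"] lam_diff_pos[of k] by (simp add: weight_def)
  qed
  then have "E_seq lam (E_inv lam y) n = 1 / lam n * (\<Sum>k\<le>n. lam k * y k - prev (\<lambda>i. lam i * y i) k)"
    by (simp add: E_seq_def)
  also have "(\<Sum>k\<le>n. lam k * y k - prev (\<lambda>i. lam i * y i) k) = lam n * y n"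
    by (induction n) (auto simp: prev_def)
  finally show "E_seq lam (E_inv lam y) n = y n"
    using lam(2)[of n] by simp
qed

lemma E_inv_E_seq: "E_inv lam (E_seq lam x) = x"
proof
  fix n
  define y where "y = E_seq lam x"
  have y: "lam k * y k = (\<Sum>j\<le>k. (lam j - prev lam j) *
      (fibo j / fibo (j + 1) * x j - fibo (j + 1) / fibo j * prev x j))" for k
    using lam(2)[of k] by (simp add: y_def E_seq_def)
  have diff: "lam k * y k - prev (\<lambda>i. lam i * y i) k = (lam k - prev lam k) *
      (fibo k / fibo (k + 1) * x k - fibo (k + 1) / fibo k * prev x k)" for k
    unfolding y by (cases k) (auto simp: prev_def)
  \<comment> \<open>The right side is the increment of \<open>x k / (fibo (k + 1))^2\<close>, so its
    sum telescopes to the last term.\<close>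
  have "weight lam k * (lam k * y k - prev (\<lambda>i. lam i * y i) k) =
      x k / (fibo (k + 1))\<^sup>2 - prev x k / (fibo k)\<^sup>2" for k
    unfolding diff using fibo_pos[of k] fibo_pos[of "k + 1"] lam_diff_pos[of k]
    by (simp add: weight_def field_simps power2_eq_square)
  then have "(\<Sum>k\<le>n. weight lam k * (lam k * y k - prev (\<lambda>i. lam i * y i) k)) =
      (\<Sum>k\<le>n. x k / (fibo (k + 1))\<^sup>2 - prev x k / (fibo k)\<^sup>2)"
    by simp
  also have "\<dots> = x n / (fibo (n + 1))\<^sup>2"
    by (induction n) (auto simp: prev_def)
  finally show "E_inv lam (E_seq lam x) n = x n"
    using fibo_pos[of "n + 1"] unfolding y_def[symmetric] E_inv_eq by simp
qed

end

lemma E_inv_unit_vec: "E_inv lam (unit_vec j) k = E_inv_coeff lam k j"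
proof (cases "j \<le> k")
  case True
  then have "E_inv lam (unit_vec j) k = (\<Sum>i\<in>{..k}. if i = j then E_inv_coeff lam k i else 0)"
    unfolding E_inv_def by (intro sum.cong) (auto simp: unit_vec_def)
  then show ?thesis
    using True by simp
qed (auto simp: E_inv_def E_inv_coeff_def unit_vec_def intro!: sum.neutral)

text \<open>\<open>ahat\<close> is the product of \<open>A\<close> with the inverse matrix: in
  column \<open>j\<close> the diagonal entry gives its first summand, and the entries below the
  diagonal share the factor \<open>c\<close>, which leaves the tail series.\<close>

lemma ahat_sums:
  assumes "summable (\<lambda>k. A n k * E_inv_coeff lam k j)"
  shows "(\<lambda>k. A n k * E_inv_coeff lam k j) sums ahat lam A n j"
proof -
  define c where "c = lam j * (weight lam j - weight lam (j + 1))"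
  define g where "g i = (fibo (i + (j + 1) + 1))\<^sup>2 * A n (i + (j + 1))" for i
  have tail: "A n (i + (j + 1)) * E_inv_coeff lam (i + (j + 1)) j = c * g i" for i
    by (simp add: E_inv_coeff_def c_def g_def algebra_simps)
  have "summable (\<lambda>i. c * g i)"
    using summable_ignore_initial_segment[OF assms, of "j + 1"] unfolding tail .
  \<comment> \<open>For \<open>c = 0\<close> the series of \<open>g\<close> may diverge; the zero
    factor then cancels whatever value \<open>suminf\<close> takes.\<close>
  then have cg: "(\<Sum>i. c * g i) = c * (\<Sum>i. g i)"
    by (cases "c = 0") (auto simp: suminf_mult summable_cmult_iff)
  have "(\<Sum>k<j + 1. A n k * E_inv_coeff lam k j) = A n j * E_inv_coeff lam j j"
    by (simp add: E_inv_coeff_def)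
  then have "(\<Sum>k. A n k * E_inv_coeff lam k j) = c * (\<Sum>i. g i) + A n j * E_inv_coeff lam j j"
    using suminf_split_initial_segment[OF assms, of "j + 1"] by (simp only: tail cg)
  also have "\<dots> = ahat lam A n j"
    by (simp add: ahat_def E_inv_coeff_def c_def g_def weight_def prev_def algebra_simps)
  finally show ?thesis
    using assms by (simp add: sums_iff)
qed

section \<open>Row series of \<open>A\<close> expressed through \<open>ahat\<close>\<close>

context conjugate_pair
begin

text \<open>The coefficient of \<open>y j\<close> in the first \<open>m\<close> terms is a partial
  sum of a column series, so \<open>phi m\<close> tends coordinatewise to the products with
  \<open>ahat\<close>; norm convergence in \<open>ell 1\<close> upgrades this to convergence of the
  sums.\<close>

lemma ahat_representation:
  assumes sm: "\<And>y. y \<in> ell p \<Longrightarrow> summable (\<lambda>k. A n k * E_inv lam y k)" and y: "y \<in> ell p"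
  shows "summable (\<lambda>j. \<bar>ahat lam A n j * y j\<bar>)"
    and "(\<Sum>k. A n k * E_inv lam y k) = (\<Sum>j. ahat lam A n j * y j)"
proof -
  define phi where "phi m j = (\<Sum>k<m. A n k * E_inv_coeff lam k j) * y j" for m j
  have phi0: "phi m j = 0" if "j \<notin> {..<m}" for m j
    using that by (auto simp: phi_def E_inv_coeff_def)
  have smphi: "summable (\<lambda>j. \<bar>phi m j\<bar>)" for m
    by (rule summable_finite[of "{..<m}"]) (auto simp: phi0)
  have phi: "(\<Sum>j. phi m j * z j) = (\<Sum>k<m. A n k * E_inv lam (\<lambda>j. y j * z j) k)" for m z
  proof -
    have "(\<Sum>j. phi m j * z j) = (\<Sum>j<m. phi m j * z j)"
      by (rule suminf_finite) (auto simp: phi0)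
    also have "\<dots> = (\<Sum>k<m. \<Sum>j<m. A n k * E_inv_coeff lam k j * (y j * z j))"
      unfolding phi_def by (subst sum.swap) (simp add: sum_distrib_right mult.assoc)
    also have "\<dots> = (\<Sum>k<m. \<Sum>j\<le>k. A n k * E_inv_coeff lam k j * (y j * z j))"
      by (intro sum.cong sum.mono_neutral_right) (auto simp: E_inv_coeff_def)
    finally show ?thesis
      by (simp add: E_inv_def sum_distrib_left mult.assoc)
  qed
  obtain u where u: "(\<lambda>m. lp_norm 1 (\<lambda>j. phi m j - u j)) \<longlonglongrightarrow> 0"
  proof (rule weakly_convergent_imp_norm_convergent[OF smphi])
    fix z :: rseq assume z: "\<And>k. \<bar>z k\<bar> \<le> 1"
    \<comment> \<open>Testing \<open>phi m\<close> with \<open>z\<close> amounts to replacing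
      \<open>y\<close> by this product, for which the row series converges as well.\<close>
    have "(\<lambda>j. y j * z j) \<in> ell p"
      by (rule ell_mono[OF y]) (simp add: abs_mult mult_left_le z)
    then show "convergent (\<lambda>m. \<Sum>j. phi m j * z j)"
      unfolding phi using summable_LIMSEQ[OF sm] by (auto simp: convergent_def)
  qed
  have "u j = ahat lam A n j * y j" for j
  proof (rule LIMSEQ_unique)
    show "(\<lambda>m. phi m j) \<longlonglongrightarrow> u j"
      by (rule one.coordinate_limit[OF u])
    have "summable (\<lambda>k. A n k * E_inv_coeff lam k j)"
      using sm[OF unit_vec_in_ell[of j]] by (simp add: E_inv_unit_vec)
    then show "(\<lambda>m. phi m j) \<longlonglongrightarrow> ahat lam A n j * y j"
      unfolding phi_def using ahat_sums by (intro tendsto_mult tendsto_const) (simp add: sums_def)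
  qed
  then have u_eq: "u = (\<lambda>j. ahat lam A n j * y j)"
    by auto
  show "summable (\<lambda>j. \<bar>ahat lam A n j * y j\<bar>)"
    using one.ell_limit[OF _ u] smphi by (simp add: ell_1_iff u_eq)
  have "(\<lambda>m. \<Sum>j. phi m j) \<longlonglongrightarrow> (\<Sum>j. ahat lam A n j * y j)"
    using suminf_limit[OF smphi u] by (simp add: u_eq)
  then have "(\<lambda>m. \<Sum>k<m. A n k * E_inv lam y k) \<longlonglongrightarrow> (\<Sum>j. ahat lam A n j * y j)"
    using phi[of _ "\<lambda>_. 1"] by simp
  then show "(\<Sum>k. A n k * E_inv lam y k) = (\<Sum>j. ahat lam A n j * y j)"
    by (rule LIMSEQ_unique[OF summable_LIMSEQ[OF sm[OF y]]])
qed

end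

section \<open>Transfer of compactness from the domain space to \<open>ell p\<close>\<close>

lemma mat_class_imp_linear:
  assumes "A \<in> mat_class X Y"
  shows "\<forall>x\<in>X. \<forall>y\<in>X. \<forall>a b. mat_op A (\<lambda>k. a * x k + b * y k) = (\<lambda>k. a * mat_op A x k + b * mat_op A y k)"
proof (intro ballI allI ext)
  fix x y a b n assume "x \<in> X" "y \<in> X"
  then have "summable (\<lambda>k. A n k * x k)" "summable (\<lambda>k. A n k * y k)"
    using assms by (auto simp: mat_class_def)
  then have "(\<lambda>k. a * (A n k * x k) + b * (A n k * y k)) sums (a * mat_op A x n + b * mat_op A y n)"
    unfolding mat_op_def by (intro sums_add sums_mult summable_sums)
  then show "mat_op A (\<lambda>k. a * x k + b * y k) n = a * mat_op A x n + b * mat_op A y n"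
    by (simp add: mat_op_def sums_iff algebra_simps)
qed

lemma compact_operator_iff:
  assumes "A \<in> mat_class X Y"
  shows "compact_operator X NX Y NY (mat_op A) \<longleftrightarrow>
     (\<forall>x :: nat \<Rightarrow> rseq. (\<forall>n. x n \<in> X) \<and> (\<exists>B::real. \<forall>n. NX (x n) \<le> ennreal B) \<longrightarrow>
        (\<exists>s. strict_mono s \<and> (\<exists>y\<in>Y. (\<lambda>n. NY (\<lambda>k. mat_op A (x (s n)) k - y k)) \<longlonglongrightarrow> 0)))"
  using mat_class_imp_linear[OF assms] assms unfolding compact_operator_def mat_class_def by blast

text \<open>\<open>E_inv\<close> matches the bounded sequences of both spaces, and the images
  coincide. \<open>Y\<close> and \<open>NY\<close> are arbitrary, so one transfer serves all three
  targets.\<close>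

theorem (in conjugate_pair) ell_lam_reduction:
  assumes lam: "strict_mono lam" "\<And>k. 0 < lam k" and A: "A \<in> mat_class (ell_lam lam p) Y"
  shows "ahat lam A \<in> mat_class (ell p) Y"
    and "compact_operator (ell_lam lam p) (ell_lam_norm lam p) Y NY (mat_op A) \<longleftrightarrow>
      compact_operator (ell p) (lp_norm p) Y NY (mat_op (ahat lam A))"
proof -
  have E: "E_inv lam y \<in> ell_lam lam p \<longleftrightarrow> y \<in> ell p" for y
    by (simp add: ell_lam_def E_seq_E_inv[OF lam])
  have sm: "summable (\<lambda>k. A n k * E_inv lam y k)" if "y \<in> ell p" for n y
    using A that by (simp add: mat_class_def E)
  have op: "mat_op A (E_inv lam y) = mat_op (ahat lam A) y" if "y \<in> ell p" for y
    using ahat_representation(2)[of A _ lam, OF sm that] by (simp add: mat_op_def)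
  show mc: "ahat lam A \<in> mat_class (ell p) Y"
    using ahat_representation(1)[of A _ lam, OF sm] A op E
    by (force simp: mat_class_def intro: summable_rabs_cancel)
  have surj: "(\<forall>x::nat \<Rightarrow> rseq. P x) \<longleftrightarrow> (\<forall>y::nat \<Rightarrow> rseq. P (\<lambda>n. E_inv lam (y n)))" for P
  proof safe
    fix x :: "nat \<Rightarrow> rseq" assume "\<forall>y::nat \<Rightarrow> rseq. P (\<lambda>n. E_inv lam (y n))"
    then have "P (\<lambda>n. E_inv lam (E_seq lam (x n)))" ..
    then show "P x" by (simp add: E_inv_E_seq[OF lam])
  qed auto
  show "compact_operator (ell_lam lam p) (ell_lam_norm lam p) Y NY (mat_op A) \<longleftrightarrow>
      compact_operator (ell p) (lp_norm p) Y NY (mat_op (ahat lam A))"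
    unfolding compact_operator_iff[OF A] compact_operator_iff[OF mc]
    by (subst surj) (auto simp: E ell_lam_norm_def E_seq_E_inv[OF lam] op)
qed

subsection \<open>Compactness and uniformly small tails\<close>

lemma (in conjugate_pair) mat_class_rows:
  "B \<in> mat_class (ell p) Y \<Longrightarrow> B n \<in> ell q"
  by (rule in_dual_if_summable) (simp add: mat_class_def)

text \<open>The rows lie in \<open>ell q\<close>, so Hoelder bounds every coordinate of the images;
  Bolzano-Weierstrass in each coordinate and a diagonal choice do the rest.\<close>

lemma (in conjugate_pair) mat_op_diagonal_subsequence:
  fixes x :: "nat \<Rightarrow> rseq"
  assumes B: "B \<in> mat_class (ell p) Y" and C: "0 < C" "\<And>i. lp_norm p (x i) \<le> ennreal C"
  obtains t where "strict_mono t" "\<And>n. convergent (\<lambda>i. mat_op B (x (t i)) n)"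
proof -
  define P where "P n s \<longleftrightarrow> convergent (\<lambda>i. mat_op B (x (s i)) n)" for n and s :: "nat \<Rightarrow> nat"
  have ex: "\<exists>r'. strict_mono r' \<and> P n (s \<circ> r')" for n and s :: "nat \<Rightarrow> nat"
  proof -
    have "lp_norm q (B n) < \<infinity>"
      using mat_class_rows[OF B, of n] by (simp add: ell_def)
    then obtain c where c: "0 \<le> c" "lp_norm q (B n) = ennreal c"
      by (cases "lp_norm q (B n)") auto
    have bound: "\<bar>mat_op B (x i) n\<bar> \<le> C * c" for i
    proof -
      have "ennreal \<bar>mat_op B (x i) n\<bar> \<le> pairing (B n) (x i)"
        unfolding mat_op_def by (rule suminf_le_pairing)
      also have "\<dots> \<le> ennreal C * lp_norm q (B n)"
        by (rule Holder[OF C])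
      also have "\<dots> = ennreal (C * c)"
        using C c by (simp add: ennreal_mult)
      finally show ?thesis
        using C c by simp
    qed
    have "bounded (range (\<lambda>i. mat_op B (x (s i)) n))"
      unfolding bounded_iff using bound by auto
    then obtain l r' where "strict_mono r'" "((\<lambda>i. mat_op B (x (s i)) n) \<circ> r') \<longlonglongrightarrow> l"
      using bounded_imp_convergent_subsequence by blast
    then show ?thesis
      by (auto simp: P_def convergent_def o_def)
  qed
  interpret subseqs P
    by unfold_locales (rule ex)
  \<comment> \<open>The diagonal sequence refines the \<open>k\<close>-th choice only from index
    \<open>Suc k\<close> on; convergence ignores the initial segment, which is restored
    below.\<close>
  have "P k (diagseq \<circ> (+) (Suc k))" for k
  proof (rule diagseq_holds)
    fix r s :: "nat \<Rightarrow> nat" and n assume "strict_mono r" "P n s"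
    then show "P n (s \<circ> r)"
      using convergent_subseq_convergent[of "\<lambda>i. mat_op B (x (s i)) n" r] by (simp add: P_def o_def)
  qed
  moreover have "diagseq \<circ> (+) (Suc k) = (\<lambda>i. diagseq (i + Suc k))" for k
    by (simp add: fun_eq_iff add.commute)
  ultimately have "P k (\<lambda>i. diagseq (i + Suc k))" for k
    by metis
  then have "convergent (\<lambda>i. mat_op B (x (diagseq (i + Suc k))) k)" for k
    by (subst (asm) P_def)
  then have "convergent (\<lambda>i. mat_op B (x (diagseq i)) k)" for k
    using convergent_ignore_initial_segment[of "\<lambda>i. mat_op B (x (diagseq i)) k" "Suc k"] by blast
  then show thesis
    using that subseq_diagseq by blast
qed

text \<open>\<open>tau m v\<close> measures the part of \<open>v\<close> beyond index \<open>m\<close> (for convergent \<open>v\<close>, after the limit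
  has been subtracted).  The constant \<open>2\<close> is what this subtraction costs.\<close>

locale tail_space = target: conjugate_pair r s for r s +
  fixes Y :: "rseq set" and tau :: "nat \<Rightarrow> rseq \<Rightarrow> ennreal"
  assumes closed: "\<And>v u. (\<And>i. v i \<in> Y) \<Longrightarrow> (\<lambda>i. lp_norm r (\<lambda>k. v i k - u k)) \<longlonglongrightarrow> 0 \<Longrightarrow> u \<in> Y"
    and tau_perturb: "\<And>u v m. u \<in> Y \<Longrightarrow> v \<in> Y \<Longrightarrow> tau m v \<le> tau m u + 2 * lp_norm r (\<lambda>k. v k - u k)"
    and tau_tendsto: "\<And>u. u \<in> Y \<Longrightarrow> (\<lambda>m. tau m u) \<longlonglongrightarrow> 0"
    and norm_le_tau: "\<And>v m. v \<in> Y \<Longrightarrow> lp_norm r v \<le> ennreal (\<Sum>n\<le>m. \<bar>v n\<bar>) + 2 * tau m v"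
    and tau_scale: "\<And>v c m. v \<in> Y \<Longrightarrow> tau m (\<lambda>k. c * v k) = ennreal \<bar>c\<bar> * tau m v"
    and tau_antimono: "\<And>v m m'. m \<le> m' \<Longrightarrow> tau m' v \<le> tau m v"
begin

text \<open>If the tails stay above \<open>e\<close>, unit-ball vectors \<open>y m\<close> witness
  it, and the limit of a subsequence of their images, whose own tails vanish, contradicts
  \<open>tau_perturb\<close>. Conversely, a diagonal subsequence has convergent heads and uniformly
  small tails, hence is Cauchy.\<close>

theorem compact_operator_iff_tails:
  assumes pq: "conjugate_pair p q" and B: "B \<in> mat_class (ell p) Y"
  shows "compact_operator (ell p) (lp_norm p) Y (lp_norm r) (mat_op B) \<longleftrightarrow>
    (\<lambda>m. SUP y\<in>unit_ball p. tau m (mat_op B y)) \<longlonglongrightarrow> 0"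
proof
  interpret conjugate_pair p q by (rule pq)
  have img: "mat_op B y \<in> Y" if "y \<in> ell p" for y
    using B that by (auto simp: mat_class_def)
  have lin: "mat_op B (\<lambda>k. a * x k + b * y k) = (\<lambda>k. a * mat_op B x k + b * mat_op B y k)"
    if "x \<in> ell p" "y \<in> ell p" for x y a b
    using mat_class_imp_linear[OF B] that by blast
  {
    assume compact: "compact_operator (ell p) (lp_norm p) Y (lp_norm r) (mat_op B)"
    show "(\<lambda>m. SUP y\<in>unit_ball p. tau m (mat_op B y)) \<longlonglongrightarrow> 0"
    proof (rule ccontr)
      assume "\<not> ?thesis"
      then obtain e where e: "0 < e"
          "\<not> (\<forall>\<^sub>F m in sequentially. (SUP y\<in>unit_ball p. tau m (mat_op B y)) \<le> ennreal e)"
        unfolding tendsto_0_iff_ennreal by blast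
      \<comment> \<open>Tails decrease in \<open>m\<close>, so a bound by \<open>e\<close> at a
        single index would persist at all later ones.\<close>
      have "\<exists>y\<in>unit_ball p. ennreal e < tau m (mat_op B y)" for m
      proof (rule ccontr)
        assume "\<not> ?thesis"
        then have "tau m' (mat_op B y) \<le> ennreal e" if "m \<le> m'" "y \<in> unit_ball p" for m' y
          using that tau_antimono[OF that(1), of "mat_op B y"] by (meson not_le order_trans)
        then have "\<forall>\<^sub>F m in sequentially. (SUP y\<in>unit_ball p. tau m (mat_op B y)) \<le> ennreal e"
          by (auto simp: eventually_sequentially SUP_le_iff)
        with e show False by blast
      qed
      then obtain y where y: "\<And>m. y m \<in> unit_ball p" "\<And>m. ennreal e < tau m (mat_op B (y m))"
        by metis
      have "\<And>m. y m \<in> ell p" "\<And>m. lp_norm p (y m) \<le> ennreal 1"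
        using y(1) unit_ball_subset by (auto simp: unit_ball_def)
      then obtain s u where s: "strict_mono s" and u: "u \<in> Y"
          and lim: "(\<lambda>n. lp_norm r (\<lambda>k. mat_op B (y (s n)) k - u k)) \<longlonglongrightarrow> 0"
        using compact unfolding compact_operator_iff[OF B] by blast
      have "(\<lambda>n. tau (s n) u + 2 * lp_norm r (\<lambda>k. mat_op B (y (s n)) k - u k)) \<longlonglongrightarrow> 0 + 2 * 0"
        using LIMSEQ_subseq_LIMSEQ[OF tau_tendsto[OF u] s] lim
        by (intro tendsto_add ennreal_tendsto_cmult) (auto simp: o_def)
      then have "\<forall>\<^sub>F n in sequentially. tau (s n) u + 2 * lp_norm r (\<lambda>k. mat_op B (y (s n)) k - u k) < ennreal e"
        using e(1) by (intro order_tendstoD) auto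
      then obtain n where "tau (s n) u + 2 * lp_norm r (\<lambda>k. mat_op B (y (s n)) k - u k) < ennreal e"
        by (auto simp: eventually_sequentially)
      moreover have "tau (s n) (mat_op B (y (s n))) \<le> tau (s n) u + 2 * lp_norm r (\<lambda>k. mat_op B (y (s n)) k - u k)"
        using \<open>\<And>m. y m \<in> ell p\<close> by (intro tau_perturb u img)
      ultimately show False
        using y(2)[of "s n"] by (meson less_trans not_le order.strict_trans1)
    qed
  next
    assume tails: "(\<lambda>m. SUP y\<in>unit_ball p. tau m (mat_op B y)) \<longlonglongrightarrow> 0"
    show "compact_operator (ell p) (lp_norm p) Y (lp_norm r) (mat_op B)"
      unfolding compact_operator_iff[OF B]
    proof (intro allI impI, elim conjE exE)
      fix x :: "nat \<Rightarrow> rseq" and C0 :: real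
      assume x: "\<forall>n. x n \<in> ell p" and C0: "\<forall>n. lp_norm p (x n) \<le> ennreal C0"
      define C where "C = max 1 C0"
      have C: "0 < C" "\<And>n. lp_norm p (x n) \<le> ennreal C"
        using C0 by (auto simp: C_def intro: order_trans ennreal_leI)
      obtain t where t: "strict_mono t" "\<And>n. convergent (\<lambda>i. mat_op B (x (t i)) n)"
        using mat_op_diagonal_subsequence[where x = x, OF B C] by blast
      define w where "w i = mat_op B (x (t i))" for i
      have wY: "w i \<in> Y" for i
        using img x by (simp add: w_def)
      have w_diff: "(\<lambda>k. w i k - w j k) = mat_op B (\<lambda>k. x (t i) k - x (t j) k)" for i j
        using lin[of "x (t i)" "x (t j)" 1 "-1"] x by (simp add: w_def)
      have w_tail: "tau m (\<lambda>k. w i k - w j k) \<le> ennreal (2 * C) * (SUP y\<in>unit_ball p. tau m (mat_op B y))"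
        for m i j
      proof -
        define d where "d k = x (t i) k - x (t j) k" for k
        have d: "d \<in> ell p"
          using x ell_diff by (simp add: d_def[abs_def])
        have "lp_norm p d \<le> ennreal C + ennreal C"
          unfolding d_def by (rule order_trans[OF norm_diff add_mono[OF C(2) C(2)]])
        then have dC: "lp_norm p d \<le> ennreal (2 * C)"
          using C by (simp flip: ennreal_plus)
        have "mat_op B (\<lambda>k. (1 / (2 * C)) * d k) = (\<lambda>k. (1 / (2 * C)) * mat_op B d k)"
          using lin[OF d d, of "1 / (2 * C)" 0] by simp
        then have "mat_op B d = (\<lambda>k. (2 * C) * mat_op B (\<lambda>k. (1 / (2 * C)) * d k) k)"
          using C by (simp add: fun_eq_iff)
        then have "tau m (mat_op B d) = ennreal (2 * C) * tau m (mat_op B (\<lambda>k. (1 / (2 * C)) * d k))"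
          using tau_scale[OF img[OF ell_scale[OF d]], of m "2 * C" "1 / (2 * C)"] C by simp
        also have "\<dots> \<le> ennreal (2 * C) * (SUP y\<in>unit_ball p. tau m (mat_op B y))"
          using scale_into_unit_ball[OF _ dC] C by (intro mult_left_mono SUP_upper) auto
        finally show ?thesis
          by (simp add: w_diff d_def[abs_def])
      qed
      obtain u where u: "(\<lambda>i. lp_norm r (\<lambda>k. w i k - u k)) \<longlonglongrightarrow> 0"
      proof (rule target.norm_Cauchy_limit)
        fix e :: real assume e: "0 < e"
        \<comment> \<open>Differences of terms have norm at most \<open>2 * C\<close>, so
          \<open>e / (8 * C)\<close> yields tails of \<open>e / 4\<close>, doubled by
          \<open>norm_le_tau\<close>; the head takes the other \<open>e / 2\<close>.\<close>
        have "\<forall>\<^sub>F m in sequentially. (SUP y\<in>unit_ball p. tau m (mat_op B y)) \<le> ennreal (e / (8 * C))"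
          using tails e C unfolding tendsto_0_iff_ennreal by simp
        then obtain m where m: "(SUP y\<in>unit_ball p. tau m (mat_op B y)) \<le> ennreal (e / (8 * C))"
          by (auto simp: eventually_sequentially)
        obtain l where l: "\<And>n. (\<lambda>i. w i n) \<longlonglongrightarrow> l n"
          using t(2) unfolding w_def convergent_def by metis
        have "(\<lambda>i. \<Sum>n\<le>m. \<bar>w i n - l n\<bar>) \<longlonglongrightarrow> (\<Sum>n\<le>m. \<bar>l n - l n\<bar>)"
          by (intro tendsto_intros l)
        then have "\<forall>\<^sub>F i in sequentially. (\<Sum>n\<le>m. \<bar>w i n - l n\<bar>) < e / 4"
          using e by (intro order_tendstoD) auto
        then obtain M where M: "\<And>i. M \<le> i \<Longrightarrow> (\<Sum>n\<le>m. \<bar>w i n - l n\<bar>) < e / 4"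
          by (auto simp: eventually_sequentially)
        have "lp_norm r (\<lambda>k. w i k - w j k) \<le> ennreal e" if "M \<le> i" "M \<le> j" for i j
        proof -
          have "(\<Sum>n\<le>m. \<bar>w i n - w j n\<bar>) \<le> (\<Sum>n\<le>m. \<bar>w i n - l n\<bar> + \<bar>w j n - l n\<bar>)"
            by (intro sum_mono) auto
          also have "\<dots> \<le> e / 2"
            using M[OF that(1)] M[OF that(2)] by (simp add: sum.distrib)
          finally have head: "(\<Sum>n\<le>m. \<bar>w i n - w j n\<bar>) \<le> e / 2" .
          have "tau m (\<lambda>k. w i k - w j k) \<le> ennreal (2 * C) * ennreal (e / (8 * C))"
            using m by (intro order_trans[OF w_tail] mult_left_mono) auto
          also have "\<dots> = ennreal (e / 4)"
            using e C by (simp flip: ennreal_mult)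
          finally have "2 * tau m (\<lambda>k. w i k - w j k) \<le> ennreal 2 * ennreal (e / 4)"
            by (simp add: mult_left_mono)
          also have "\<dots> = ennreal (e / 2)"
            using e ennreal_mult[of 2 "e / 4"] by simp
          finally have tail: "2 * tau m (\<lambda>k. w i k - w j k) \<le> ennreal (e / 2)" .
          have "(\<lambda>k. w i k - w j k) \<in> Y"
            unfolding w_diff using x ell_diff img by blast
          then have "lp_norm r (\<lambda>k. w i k - w j k) \<le> ennreal (\<Sum>n\<le>m. \<bar>w i n - w j n\<bar>) + 2 * tau m (\<lambda>k. w i k - w j k)"
            by (rule norm_le_tau)
          also have "\<dots> \<le> ennreal (e / 2) + ennreal (e / 2)"
            using head tail by (intro add_mono ennreal_leI)
          also have "\<dots> = ennreal e"
            using e by (simp flip: ennreal_plus)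
          finally show ?thesis .
        qed
        then show "\<exists>M. \<forall>i\<ge>M. \<forall>j\<ge>M. lp_norm r (\<lambda>k. w i k - w j k) \<le> ennreal e"
          by blast
      qed
      then have "u \<in> Y"
        by (rule closed[OF wY])
      with t(1) u show "\<exists>s. strict_mono s \<and> (\<exists>y\<in>Y. (\<lambda>n. lp_norm r (\<lambda>k. mat_op B (x (s n)) k - y k)) \<longlonglongrightarrow> 0)"
        unfolding w_def by blast
    qed
  }
qed

end

subsection \<open>Tails in the target spaces\<close>

text \<open>On \<open>c_null\<close> the subtracted limit is 0, so one functional serves both
  \<open>c_null\<close> and \<open>c_conv\<close>.\<close>

definition limit_tail :: "nat \<Rightarrow> rseq \<Rightarrow> ennreal" where
  "limit_tail m v = (SUP n\<in>{m..}. ennreal \<bar>v n - lim v\<bar>)"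

lemma lp_norm_infinity_le_iff:
  "0 \<le> c \<Longrightarrow> lp_norm \<infinity> v \<le> ennreal c \<longleftrightarrow> (\<forall>k. \<bar>v k\<bar> \<le> c)"
  unfolding lp_norm_infinity by (simp add: SUP_le_iff)

lemma limit_tail_le_iff:
  "0 \<le> c \<Longrightarrow> limit_tail m v \<le> ennreal c \<longleftrightarrow> (\<forall>n\<ge>m. \<bar>v n - lim v\<bar> \<le> c)"
  unfolding limit_tail_def by (simp add: SUP_le_iff Ball_def)

text \<open>A perturbation of size \<open>d\<close> moves the coordinates and the limit by at most
  \<open>d\<close> each, whence the factor 2.\<close>

lemma limit_tail_perturb:
  assumes u: "convergent u" and v: "convergent v"
  shows "limit_tail m v \<le> limit_tail m u + 2 * lp_norm \<infinity> (\<lambda>k. v k - u k)"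
proof (cases "lp_norm \<infinity> (\<lambda>k. v k - u k)")
  case d: (real d)
  show ?thesis
  proof (cases "limit_tail m u")
    case (real t)
    have diff: "\<bar>v n - u n\<bar> \<le> d" for n
      using lp_norm_infinity_le_iff[OF d(1), of "\<lambda>k. v k - u k"] d(2) by (metis order_refl)
    have "(\<lambda>n. \<bar>v n - u n\<bar>) \<longlonglongrightarrow> \<bar>lim v - lim u\<bar>"
      using u v by (intro tendsto_intros) (auto simp: convergent_LIMSEQ_iff)
    then have lim: "\<bar>lim v - lim u\<bar> \<le> d"
      by (rule LIMSEQ_le_const2) (use diff in auto)
    have "\<bar>v n - lim v\<bar> \<le> t + 2 * d" if "m \<le> n" for n
    proof -
      have "\<bar>u n - lim u\<bar> \<le> t"
        using limit_tail_le_iff[of t m u] real that by auto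
      then show ?thesis
        using diff[of n] lim by linarith
    qed
    then have "limit_tail m v \<le> ennreal (t + 2 * d)"
      using real d by (intro iffD2[OF limit_tail_le_iff]) auto
    also have "\<dots> = ennreal t + 2 * ennreal d"
      using real d by (simp add: ennreal_mult flip: ennreal_numeral)
    finally show ?thesis
      using real d by simp
  qed simp
qed (simp add: ennreal_mult_top)

lemma limit_tail_tendsto:
  assumes "convergent u" shows "(\<lambda>m. limit_tail m u) \<longlonglongrightarrow> 0"
  unfolding tendsto_0_iff_ennreal
proof (intro allI impI)
  fix e :: real assume e: "0 < e"
  have "u \<longlonglongrightarrow> lim u"
    using assms by (simp add: convergent_LIMSEQ_iff)
  then obtain M where M: "\<And>n. M \<le> n \<Longrightarrow> \<bar>u n - lim u\<bar> < e"
    using LIMSEQ_D[OF _ e] by fastforce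
  have "limit_tail m u \<le> ennreal e" if "M \<le> m" for m
    using e M that by (auto simp: limit_tail_le_iff intro: less_imp_le order_trans)
  then show "\<forall>\<^sub>F m in sequentially. limit_tail m u \<le> ennreal e"
    by (auto simp: eventually_sequentially)
qed

text \<open>Beyond \<open>m\<close>, \<open>v n\<close> is compared with \<open>v m\<close> through
  the limit, at the cost of two tails; for this the head has to contain the index \<open>m\<close>
  itself.\<close>

lemma norm_le_limit_tail:
  "lp_norm \<infinity> v \<le> ennreal (\<Sum>n\<le>m. \<bar>v n\<bar>) + 2 * limit_tail m v"
proof (cases "limit_tail m v")
  case (real t)
  have t: "\<bar>v n - lim v\<bar> \<le> t" if "m \<le> n" for n
    using limit_tail_le_iff[of t m v] real that by auto
  have head: "\<bar>v n\<bar> \<le> (\<Sum>n\<le>m. \<bar>v n\<bar>)" if "n \<le> m" for n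
    using that by (intro member_le_sum) auto
  have "\<bar>v n\<bar> \<le> (\<Sum>n\<le>m. \<bar>v n\<bar>) + 2 * t" for n
  proof (cases "n \<le> m")
    case True
    then show ?thesis
      using head[of n] real by auto
  next
    case False
    then show ?thesis
      using t[of n] t[of m] head[of m] by auto
  qed
  then have "lp_norm \<infinity> v \<le> ennreal ((\<Sum>n\<le>m. \<bar>v n\<bar>) + 2 * t)"
    using real by (intro iffD2[OF lp_norm_infinity_le_iff]) (auto intro!: add_nonneg_nonneg sum_nonneg)
  also have "\<dots> = ennreal (\<Sum>n\<le>m. \<bar>v n\<bar>) + 2 * ennreal t"
    using real by (simp add: ennreal_mult sum_nonneg flip: ennreal_numeral)
  finally show ?thesis
    using real by simp
qed (simp add: ennreal_mult_top)

lemma limit_tail_scale: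
  assumes "convergent v"
  shows "limit_tail m (\<lambda>k. c * v k) = ennreal \<bar>c\<bar> * limit_tail m v"
proof -
  have "lim (\<lambda>k. c * v k) = c * lim v"
    using assms by (intro limI tendsto_mult tendsto_const) (simp add: convergent_LIMSEQ_iff)
  then have "\<bar>c * v n - lim (\<lambda>k. c * v k)\<bar> = \<bar>c\<bar> * \<bar>v n - lim v\<bar>" for n
    by (simp add: abs_mult flip: right_diff_distrib)
  then show ?thesis
    by (simp add: limit_tail_def ennreal_mult SUP_mult_left_ennreal)
qed

lemma limit_tail_space:
  assumes Y: "Y \<subseteq> c_conv"
    and closed: "\<And>v u. (\<And>i. v i \<in> Y) \<Longrightarrow> (\<lambda>i. lp_norm \<infinity> (\<lambda>k. v i k - u k)) \<longlonglongrightarrow> 0 \<Longrightarrow> u \<in> Y"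
  shows "tail_space \<infinity> 1 Y limit_tail"
proof unfold_locales
  show "limit_tail m' v \<le> limit_tail m v" if "m \<le> m'" for v m m'
    using that by (auto simp: limit_tail_def intro!: SUP_subset_mono)
qed (use Y closed in \<open>auto simp: c_conv_def simp del: infinity_ennreal_def intro!: limit_tail_perturb limit_tail_tendsto
    norm_le_limit_tail limit_tail_scale\<close>)

lemma sup_norm_approx:
  assumes "(\<lambda>i. lp_norm \<infinity> (\<lambda>k. v i k - u k)) \<longlonglongrightarrow> 0" "0 < e"
  obtains i where "\<And>k. \<bar>v i k - u k\<bar> \<le> e"
proof -
  obtain i where "lp_norm \<infinity> (\<lambda>k. v i k - u k) \<le> ennreal e"
    using assms unfolding tendsto_0_iff_ennreal by (auto simp: eventually_sequentially)
  then show thesis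
    using assms(2) by (intro that[of i]) (simp add: lp_norm_infinity_le_iff[simplified])
qed

lemma c_conv_closed:
  assumes "\<And>i. v i \<in> c_conv" "(\<lambda>i. lp_norm \<infinity> (\<lambda>k. v i k - u k)) \<longlonglongrightarrow> 0"
  shows "u \<in> c_conv"
proof -
  have "Cauchy u"
  proof (rule metric_CauchyI)
    fix e :: real assume e: "0 < e"
    then obtain i where i: "\<And>k. \<bar>v i k - u k\<bar> \<le> e / 4"
      using sup_norm_approx[OF assms(2), of "e / 4"] by auto
    have "Cauchy (v i)"
      using assms(1) by (simp add: c_conv_def Cauchy_convergent_iff)
    then obtain M where M: "\<And>m n. M \<le> m \<Longrightarrow> M \<le> n \<Longrightarrow> dist (v i m) (v i n) < e / 4"
      using e metric_CauchyD[of "v i" "e / 4"] by auto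
    have "dist (u m) (u n) < e" if "M \<le> m" "M \<le> n" for m n
      using M[OF that] i[of m] i[of n] e unfolding dist_real_def by linarith
    then show "\<exists>M. \<forall>m\<ge>M. \<forall>n\<ge>M. dist (u m) (u n) < e"
      by blast
  qed
  then show ?thesis
    by (simp add: c_conv_def Cauchy_convergent_iff)
qed

lemma c_null_closed:
  assumes "\<And>i. v i \<in> c_null" "(\<lambda>i. lp_norm \<infinity> (\<lambda>k. v i k - u k)) \<longlonglongrightarrow> 0"
  shows "u \<in> c_null"
proof -
  have "u \<longlonglongrightarrow> 0"
  proof (rule LIMSEQ_I)
    fix e :: real assume e: "0 < e"
    then obtain i where i: "\<And>k. \<bar>v i k - u k\<bar> \<le> e / 2"
      using sup_norm_approx[OF assms(2), of "e / 2"] by auto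
    have "v i \<longlonglongrightarrow> 0"
      using assms(1) by (simp add: c_null_def)
    then obtain M where M: "\<And>n. M \<le> n \<Longrightarrow> norm (v i n - 0) < e / 2"
      using LIMSEQ_D[of "v i" 0 "e / 2"] e by auto
    have "norm (u n - 0) < e" if "M \<le> n" for n
      using M[OF that] i[of n] unfolding real_norm_def diff_0_right by linarith
    then show "\<exists>M. \<forall>n\<ge>M. norm (u n - 0) < e"
      by blast
  qed
  then show ?thesis
    by (simp add: c_null_def)
qed

lemma c_null_subset: "c_null \<subseteq> c_conv"
  by (auto simp: c_null_def c_conv_def convergent_def)

interpretation c_conv: tail_space \<infinity> 1 c_conv limit_tail
  by (rule limit_tail_space[OF order_refl c_conv_closed])

interpretation c_null: tail_space \<infinity> 1 c_null limit_tail
  by (rule limit_tail_space[OF c_null_subset c_null_closed])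

section \<open>Tails of absolutely summable sequences\<close>

definition series_tail :: "nat \<Rightarrow> rseq \<Rightarrow> ennreal" where
  "series_tail m v = (\<Sum>n. ennreal \<bar>v (n + m)\<bar>)"

lemma series_tail_eq: "series_tail m v = lp_norm 1 (\<lambda>n. v (n + m))"
  by (simp add: series_tail_def lp_norm_1)

lemma norm_eq_series_tail: "lp_norm 1 v = ennreal (\<Sum>n<m. \<bar>v n\<bar>) + series_tail m v"
  using suminf_offset[of "\<lambda>n. ennreal \<bar>v n\<bar>" m]
  by (simp add: lp_norm_1 series_tail_def sum_ennreal add.commute)

lemma series_tail_le_norm: "series_tail m v \<le> lp_norm 1 v"
  unfolding norm_eq_series_tail[of v m] by simp

interpretation ell_1: tail_space 1 \<infinity> "ell 1" series_tail
proof unfold_locales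
  fix v :: rseq and m m' :: nat assume "m \<le> m'"
  then show "series_tail m' v \<le> series_tail m v"
    using series_tail_le_norm[of "m' - m" "\<lambda>n. v (n + m)"] by (simp add: series_tail_def lp_norm_1 add.assoc)
next
  fix u assume "u \<in> ell 1"
  then have sm: "summable (\<lambda>k. \<bar>u k\<bar>)"
    by (simp add: ell_1_iff)
  then have "series_tail m u = ennreal ((\<Sum>k. \<bar>u k\<bar>) - (\<Sum>k<m. \<bar>u k\<bar>))" for m
    unfolding series_tail_eq
    using summable_ignore_initial_segment[OF sm, of m] suminf_minus_initial_segment[OF sm, of m]
    by (simp add: lp_norm_1_summable)
  moreover have "(\<lambda>m. (\<Sum>k. \<bar>u k\<bar>) - (\<Sum>k<m. \<bar>u k\<bar>)) \<longlonglongrightarrow> (\<Sum>k. \<bar>u k\<bar>) - (\<Sum>k. \<bar>u k\<bar>)"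
    by (intro tendsto_intros summable_LIMSEQ sm)
  ultimately show "(\<lambda>m. series_tail m u) \<longlonglongrightarrow> 0"
    using tendsto_ennrealI by fastforce
next
  fix u v m
  have "series_tail m v \<le> series_tail m u + series_tail m (\<lambda>k. v k - u k)"
    using one.norm_triangle[of "\<lambda>n. u (n + m)" "\<lambda>n. v (n + m) - u (n + m)"] by (simp add: series_tail_eq)
  also have "\<dots> \<le> series_tail m u + 2 * lp_norm 1 (\<lambda>k. v k - u k)"
    using mult_right_mono[of 1 2 "lp_norm 1 (\<lambda>k. v k - u k)"]
    by (intro add_left_mono order_trans[OF series_tail_le_norm]) auto
  finally show "series_tail m v \<le> series_tail m u + 2 * lp_norm 1 (\<lambda>k. v k - u k)" .
next
  fix v m
  \<comment> \<open>The head below \<open>m\<close> is enlarged by the term at \<open>m\<close>, and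
    the factor 1 is then relaxed to the 2 of \<open>tail_space\<close>.\<close>
  have "lp_norm 1 v \<le> ennreal (\<Sum>n\<le>m. \<bar>v n\<bar>) + 1 * series_tail m v"
    unfolding norm_eq_series_tail[of v m] lessThan_Suc_atMost[symmetric] by (auto intro!: add_right_mono ennreal_leI)
  also have "\<dots> \<le> ennreal (\<Sum>n\<le>m. \<bar>v n\<bar>) + 2 * series_tail m v"
    by (intro add_left_mono mult_right_mono) auto
  finally show "lp_norm 1 v \<le> ennreal (\<Sum>n\<le>m. \<bar>v n\<bar>) + 2 * series_tail m v" .
qed (auto simp: series_tail_eq one.norm_scale intro: one.ell_limit)

subsection \<open>Matrix operators on \<open>\<ell>\<^sub>p\<close>\<close>

lemma mat_op_unit_vec: "mat_op B (unit_vec k) n = B n k"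
proof -
  have "mat_op B (unit_vec k) n = (\<Sum>j\<in>{k}. B n j * unit_vec k j)"
    unfolding mat_op_def by (rule suminf_finite) (auto simp: unit_vec_def)
  then show ?thesis
    by (simp add: unit_vec_def)
qed

context conjugate_pair
begin

text \<open>Unit vectors give the limits of the columns. For fixed \<open>y\<close> the products
  \<open>B n k * y k\<close> converge weakly, hence in the norm of \<open>ell 1\<close>, so the
  limit in \<open>n\<close> passes under the sum; summability against every \<open>y\<close> puts
  \<open>beta\<close> into \<open>ell q\<close>.\<close>

lemma mat_op_limit:
  assumes B: "B \<in> mat_class (ell p) Y" and Y: "Y \<subseteq> c_conv"
  defines "beta \<equiv> \<lambda>k. lim (\<lambda>n. B n k)"
  shows "beta \<in> ell q" and "y \<in> ell p \<Longrightarrow> mat_op B y \<longlonglongrightarrow> (\<Sum>k. beta k * y k)"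
proof -
  have conv: "convergent (mat_op B y)" if "y \<in> ell p" for y
    using B Y that by (auto simp: mat_class_def c_conv_def)
  have beta: "(\<lambda>n. B n k) \<longlonglongrightarrow> beta k" for k
    using conv[OF unit_vec_in_ell[of k]]
    by (simp add: beta_def convergent_LIMSEQ_iff mat_op_unit_vec[abs_def])
  have main: "summable (\<lambda>k. \<bar>beta k * y k\<bar>) \<and> mat_op B y \<longlonglongrightarrow> (\<Sum>k. beta k * y k)" if y: "y \<in> ell p" for y
  proof -
    have sm: "summable (\<lambda>k. \<bar>B n k * y k\<bar>)" for n
      by (rule summable_product[OF mat_class_rows[OF B] y])
    obtain u where u: "(\<lambda>n. lp_norm 1 (\<lambda>k. B n k * y k - u k)) \<longlonglongrightarrow> 0"
    proof (rule weakly_convergent_imp_norm_convergent[OF sm])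
      fix z :: rseq assume z: "\<And>k. \<bar>z k\<bar> \<le> 1"
      have "(\<lambda>k. y k * z k) \<in> ell p"
        by (rule ell_mono[OF y]) (simp add: abs_mult mult_left_le z)
      then show "convergent (\<lambda>n. \<Sum>k. B n k * y k * z k)"
        using conv by (simp add: mat_op_def[abs_def] mult.assoc)
    qed
    have "u = (\<lambda>k. beta k * y k)"
      using LIMSEQ_unique[OF one.coordinate_limit[OF u] tendsto_mult[OF beta tendsto_const]] by auto
    with u show ?thesis
      using one.ell_limit[OF _ u] suminf_limit[OF sm u] sm by (simp add: ell_1_iff mat_op_def[abs_def])
  qed
  show "beta \<in> ell q"
    by (rule in_dual_if_summable, rule summable_rabs_cancel) (use main in simp)
  show "mat_op B y \<longlonglongrightarrow> (\<Sum>k. beta k * y k)" if "y \<in> ell p"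
    using main that by blast
qed

text \<open>Subtracting the limit gives the functional whose coefficients are the row minus the
  column limits; interchanging the two suprema leaves one dual norm for each
  \<open>n\<close>.\<close>

lemma SUP_limit_tail:
  assumes B: "B \<in> mat_class (ell p) Y" and Y: "Y \<subseteq> c_conv"
  shows "(SUP y\<in>unit_ball p. limit_tail m (mat_op B y)) =
    (SUP n\<in>{m..}. lp_norm q (\<lambda>k. B n k - lim (\<lambda>n. B n k)))"
proof -
  interpret dual: conjugate_pair q p by (rule conj_swap)
  note lim = mat_op_limit[OF B Y]
  have "mat_op B y n - lim (mat_op B y) = (\<Sum>k. (B n k - lim (\<lambda>n. B n k)) * y k)"
    if "y \<in> unit_ball p" for y n
  proof -
    have y: "y \<in> ell p"
      using that unit_ball_subset by auto
    have "summable (\<lambda>k. B n k * y k)" "summable (\<lambda>k. lim (\<lambda>n. B n k) * y k)"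
      using summable_product[OF mat_class_rows[OF B] y] summable_product[OF lim(1) y]
      by (auto intro: summable_rabs_cancel)
    then show ?thesis
      unfolding limI[OF lim(2)[OF y]] by (simp add: mat_op_def left_diff_distrib suminf_diff)
  qed
  then have "(SUP y\<in>unit_ball p. limit_tail m (mat_op B y)) =
      (SUP y\<in>unit_ball p. SUP n\<in>{m..}. ennreal \<bar>\<Sum>k. (B n k - lim (\<lambda>n. B n k)) * y k\<bar>)"
    unfolding limit_tail_def by (intro SUP_cong) auto
  also have "\<dots> = (SUP n\<in>{m..}. SUP y\<in>unit_ball p. ennreal \<bar>\<Sum>k. (B n k - lim (\<lambda>n. B n k)) * y k\<bar>)"
    by (rule SUP_commute)
  also have "\<dots> = (SUP n\<in>{m..}. lp_norm q (\<lambda>k. B n k - lim (\<lambda>n. B n k)))"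
    by (intro SUP_cong refl dual_norm_signed[symmetric] dual.ell_diff lim(1) mat_class_rows[OF B])
  finally show ?thesis .
qed

lemma compact_into_c_conv_iff:
  assumes B: "B \<in> mat_class (ell p) c_conv"
  shows "compact_operator (ell p) (lp_norm p) c_conv (lp_norm \<infinity>) (mat_op B) \<longleftrightarrow>
    (\<lambda>m. SUP n\<in>{m..}. lp_norm q (\<lambda>k. B n k - lim (\<lambda>n. B n k))) \<longlonglongrightarrow> 0"
  unfolding c_conv.compact_operator_iff_tails[OF conjugate_pair_axioms B]
    SUP_limit_tail[OF B order_refl] ..

text \<open>The images of unit vectors are the columns of \<open>B\<close>, so here all column
  limits vanish.\<close>

lemma compact_into_c_null_iff:
  assumes B: "B \<in> mat_class (ell p) c_null"
  shows "compact_operator (ell p) (lp_norm p) c_null (lp_norm \<infinity>) (mat_op B) \<longleftrightarrow>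
    (\<lambda>m. SUP n\<in>{m..}. lp_norm q (B n)) \<longlonglongrightarrow> 0"
proof -
  have "lim (\<lambda>n. B n k) = 0" for k
  proof (rule limI)
    have "mat_op B (unit_vec k) \<in> c_null"
      using B unit_vec_in_ell by (auto simp: mat_class_def)
    then show "(\<lambda>n. B n k) \<longlonglongrightarrow> 0"
      by (simp add: c_null_def mat_op_unit_vec[abs_def])
  qed
  then show ?thesis
    using c_null.compact_operator_iff_tails[OF conjugate_pair_axioms B]
      SUP_limit_tail[OF B c_null_subset] by simp
qed

section \<open>Operators into \<open>ell 1\<close> and finite sets of rows\<close>

lemma sum_mat_op:
  assumes B: "B \<in> mat_class (ell p) Y" and y: "y \<in> ell p"
  shows "(\<Sum>n\<in>N. mat_op B y n) = (\<Sum>k. (\<Sum>n\<in>N. B n k) * y k)"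
proof -
  have "summable (\<lambda>k. B n k * y k)" for n
    using B y by (simp add: mat_class_def)
  then show ?thesis
    by (simp add: mat_op_def sum_distrib_right suminf_sum)
qed

text \<open>For a real sequence, the sum of absolute values lies between the supremum of the moduli
  of its finite subsums and twice that supremum. The factor 2 is harmless for convergence to
  0.\<close>

lemma SUP_series_tail_bounds:
  assumes B: "B \<in> mat_class (ell p) (ell 1)"
  defines "M \<equiv> \<lambda>m. SUP N\<in>{N. finite N \<and> N \<subseteq> {m..}}. lp_norm q (\<lambda>k. \<Sum>n\<in>N. B n k)"
  shows "M m \<le> (SUP y\<in>unit_ball p. series_tail m (mat_op B y))"
    and "(SUP y\<in>unit_ball p. series_tail m (mat_op B y)) \<le> 2 * M m"
proof -
  interpret dual: conjugate_pair q p by (rule conj_swap)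
  have in_q: "(\<lambda>k. \<Sum>n\<in>N. B n k) \<in> ell q" if "finite N" for N
    using that
  proof induction
    case empty
    then show ?case by (simp add: ell_def dual.norm_zero)
  next
    case (insert n N)
    then show ?case
      using dual.ell_add[OF mat_class_rows[OF B, of n]] by simp
  qed
  have signed: "lp_norm q (\<lambda>k. \<Sum>n\<in>N. B n k) = (SUP y\<in>unit_ball p. ennreal \<bar>\<Sum>n\<in>N. mat_op B y n\<bar>)"
    if "finite N" for N
    unfolding dual_norm_signed[OF in_q[OF that]]
    using unit_ball_subset by (intro SUP_cong) (auto simp: sum_mat_op[OF B])
  show "M m \<le> (SUP y\<in>unit_ball p. series_tail m (mat_op B y))"
    unfolding M_def
  proof (intro SUP_least)
    fix N assume "N \<in> {N. finite N \<and> N \<subseteq> {m..}}"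
    then have N: "finite N" "N \<subseteq> {m..}" by auto
    have "ennreal \<bar>\<Sum>n\<in>N. v n\<bar> \<le> series_tail m v" for v
    proof -
      have img: "(\<lambda>n. n + m) ` ((\<lambda>n. n - m) ` N) = N"
        using N(2) by (force simp: image_image)
      have "ennreal \<bar>\<Sum>n\<in>N. v n\<bar> \<le> (\<Sum>n\<in>N. ennreal \<bar>v n\<bar>)"
        by (simp add: sum_ennreal ennreal_leI)
      also have "\<dots> = (\<Sum>n\<in>(\<lambda>n. n - m) ` N. ennreal \<bar>v (n + m)\<bar>)"
        by (subst img[symmetric], subst sum.reindex) (auto simp: inj_on_def o_def)
      also have "\<dots> \<le> series_tail m v"
        unfolding series_tail_def using N(1) by (intro sum_le_suminf) auto
      finally show ?thesis .
    qed
    then show "lp_norm q (\<lambda>k. \<Sum>n\<in>N. B n k) \<le> (SUP y\<in>unit_ball p. series_tail m (mat_op B y))"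
      unfolding signed[OF N(1)] by (intro SUP_mono) auto
  qed
  show "(SUP y\<in>unit_ball p. series_tail m (mat_op B y)) \<le> 2 * M m"
  proof (rule SUP_least)
    fix y assume y: "y \<in> unit_ball p"
    define v where "v = mat_op B y"
    have le: "ennreal \<bar>\<Sum>n\<in>N. v n\<bar> \<le> M m" if N: "finite N" "N \<subseteq> {m..}" for N
    proof -
      have "ennreal \<bar>\<Sum>n\<in>N. v n\<bar> \<le> lp_norm q (\<lambda>k. \<Sum>n\<in>N. B n k)"
        unfolding signed[OF N(1)] v_def by (rule SUP_upper[OF y])
      also have "\<dots> \<le> M m"
        unfolding M_def using N by (intro SUP_upper) auto
      finally show ?thesis .
    qed
    have "(\<Sum>n<j. ennreal \<bar>v (n + m)\<bar>) \<le> 2 * M m" for j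
    proof -
      \<comment> \<open>Terms of one sign add up without cancellation, so each of the two parts is
        controlled by a single finite set.\<close>
      define P where "P = {n\<in>{m..<m + j}. 0 \<le> v n}"
      define N where "N = {n\<in>{m..<m + j}. v n < 0}"
      have "(\<Sum>n<j. \<bar>v (n + m)\<bar>) = (\<Sum>n\<in>{m..<m + j}. \<bar>v n\<bar>)"
        using sum.shift_bounds_nat_ivl[of "\<lambda>n. \<bar>v n\<bar>" 0 m j]
        by (simp add: lessThan_atLeast0 add.commute)
      also have "{m..<m + j} = P \<union> N"
        by (auto simp: P_def N_def)
      also have "(\<Sum>n\<in>P \<union> N. \<bar>v n\<bar>) = (\<Sum>n\<in>P. \<bar>v n\<bar>) + (\<Sum>n\<in>N. \<bar>v n\<bar>)"
        by (rule sum.union_disjoint) (auto simp: P_def N_def)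
      also have "\<dots> = (\<Sum>n\<in>P. v n) + (\<Sum>n\<in>N. - v n)"
        by (intro arg_cong2[where f = "(+)"] sum.cong) (auto simp: P_def N_def)
      also have "\<dots> \<le> \<bar>\<Sum>n\<in>P. v n\<bar> + \<bar>\<Sum>n\<in>N. v n\<bar>"
        by (simp add: sum_negf)
      finally have "ennreal (\<Sum>n<j. \<bar>v (n + m)\<bar>) \<le> ennreal \<bar>\<Sum>n\<in>P. v n\<bar> + ennreal \<bar>\<Sum>n\<in>N. v n\<bar>"
        by (simp add: ennreal_leI flip: ennreal_plus)
      also have "\<dots> \<le> M m + M m"
        by (intro add_mono le) (auto simp: P_def N_def)
      finally show ?thesis
        by (simp add: sum_ennreal mult_2)
    qed
    then show "series_tail m (mat_op B y) \<le> 2 * M m"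
      unfolding series_tail_def v_def[symmetric] suminf_eq_SUP by (rule SUP_least)
  qed
qed

lemma compact_into_ell_1_iff:
  assumes B: "B \<in> mat_class (ell p) (ell 1)"
  shows "compact_operator (ell p) (lp_norm p) (ell 1) (lp_norm 1) (mat_op B) \<longleftrightarrow>
    (\<lambda>m. SUP N\<in>{N. finite N \<and> N \<subseteq> {m..}}. lp_norm q (\<lambda>k. \<Sum>n\<in>N. B n k)) \<longlonglongrightarrow> 0"
    (is "_ \<longleftrightarrow> ?M \<longlonglongrightarrow> 0")
  unfolding ell_1.compact_operator_iff_tails[OF conjugate_pair_axioms B]
proof
  note bounds = SUP_series_tail_bounds[OF B]
  show "?M \<longlonglongrightarrow> 0" if "(\<lambda>m. SUP y\<in>unit_ball p. series_tail m (mat_op B y)) \<longlonglongrightarrow> 0"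
    by (rule tendsto_sandwich[OF _ _ tendsto_const that]) (auto intro: bounds(1) always_eventually)
  assume "?M \<longlonglongrightarrow> 0"
  then have "(\<lambda>m. 2 * ?M m) \<longlonglongrightarrow> 2 * 0"
    by (intro ennreal_tendsto_cmult) auto
  then have "(\<lambda>m. 2 * ?M m) \<longlonglongrightarrow> 0"
    by simp
  then show "(\<lambda>m. SUP y\<in>unit_ball p. series_tail m (mat_op B y)) \<longlonglongrightarrow> 0"
    by (rule tendsto_sandwich[OF _ _ tendsto_const, rotated 2]) (auto intro: bounds(2) always_eventually)
qed

end

text \<open>Tonelli's theorem, one sum being read as an integral over the counting measure.\<close>

lemma ennreal_suminf_commute:
  fixes f :: "nat \<Rightarrow> nat \<Rightarrow> ennreal"
  shows "(\<Sum>n. \<Sum>k. f n k) = (\<Sum>k. \<Sum>n. f n k)"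
  using nn_integral_suminf[of f "count_space UNIV"] by (simp add: nn_integral_count_space_nat)

text \<open>After interchanging the sums, \<open>y\<close> weights the column sums with total weight
  at most 1, so unit vectors are extremal. The value is exact, where the finite-subset bounds lose a
  factor 2.\<close>

lemma SUP_series_tail_ell_1:
  "(SUP y\<in>unit_ball 1. series_tail m (mat_op B y)) = (SUP k. \<Sum>n. ennreal \<bar>B (n + m) k\<bar>)"
proof (intro antisym SUP_least)
  fix y assume y: "y \<in> unit_ball 1"
  let ?S = "SUP k. \<Sum>n. ennreal \<bar>B (n + m) k\<bar>"
  have "series_tail m (mat_op B y) \<le> (\<Sum>n. \<Sum>k. ennreal \<bar>B (n + m) k * y k\<bar>)"
    unfolding series_tail_def mat_op_def pairing_def[symmetric]
    by (intro suminf_le suminf_le_pairing) auto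
  also have "\<dots> = (\<Sum>k. (\<Sum>n. ennreal \<bar>B (n + m) k\<bar>) * ennreal \<bar>y k\<bar>)"
    by (subst ennreal_suminf_commute) (simp add: abs_mult ennreal_mult)
  also have "\<dots> \<le> (\<Sum>k. ?S * ennreal \<bar>y k\<bar>)"
    by (intro suminf_le mult_right_mono SUP_upper) auto
  also have "\<dots> = ?S * lp_norm 1 y"
    by (simp add: lp_norm_1)
  also have "\<dots> \<le> ?S * 1"
    using y by (intro mult_left_mono) (auto simp: unit_ball_def)
  finally show "series_tail m (mat_op B y) \<le> ?S" by simp
next
  fix k
  have "unit_vec k \<in> unit_ball 1"
    using lp_norm_unit_vec[OF one.conj] by (simp add: unit_ball_def)
  then show "(\<Sum>n. ennreal \<bar>B (n + m) k\<bar>) \<le> (SUP y\<in>unit_ball 1. series_tail m (mat_op B y))"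
    by (rule SUP_upper2) (simp add: series_tail_def mat_op_unit_vec)
qed

theorem corollary6p17:
  fixes p q :: ennreal and lam :: "nat \<Rightarrow> real" and A :: "nat \<Rightarrow> nat \<Rightarrow> real"
  assumes "strict_mono lam" and "\<And>k. lam k > 0" and "filterlim lam at_top sequentially"
    and "1 \<le> p" and "conjugate_exponents p q"
  shows
    "(A \<in> mat_class (ell_lam lam p) c_null \<longrightarrow>
       (p = \<infinity> \<longrightarrow>
         (compact_operator (ell_lam lam p) (ell_lam_norm lam p) c_null (lp_norm \<infinity>) (mat_op A) \<longleftrightarrow>
          (\<lambda>r. SUP n\<in>{r..}. \<Sum>k. ennreal \<bar>ahat lam A n k\<bar>) \<longlonglongrightarrow> 0)) \<and>
       (1 < p \<and> p < \<infinity> \<longrightarrow>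
         (compact_operator (ell_lam lam p) (ell_lam_norm lam p) c_null (lp_norm \<infinity>) (mat_op A) \<longleftrightarrow>
          (\<lambda>r. SUP n\<in>{r..}. lp_norm q (ahat lam A n)) \<longlonglongrightarrow> 0)) \<and>
       (p = 1 \<longrightarrow>
         (compact_operator (ell_lam lam p) (ell_lam_norm lam p) c_null (lp_norm \<infinity>) (mat_op A) \<longleftrightarrow>
          (\<lambda>r. SUP n\<in>{r..}. SUP k. ennreal \<bar>ahat lam A n k\<bar>) \<longlonglongrightarrow> 0)))
     \<and>
     (A \<in> mat_class (ell_lam lam p) (ell 1) \<longrightarrow>
       (1 < p \<longrightarrow>
         (compact_operator (ell_lam lam p) (ell_lam_norm lam p) (ell 1) (lp_norm 1) (mat_op A) \<longleftrightarrow>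
          (\<lambda>r. SUP N\<in>{N. finite N \<and> N \<subseteq> {r..}}. lp_norm q (\<lambda>k. \<Sum>n\<in>N. ahat lam A n k)) \<longlonglongrightarrow> 0)) \<and>
       (p = 1 \<longrightarrow>
         (compact_operator (ell_lam lam p) (ell_lam_norm lam p) (ell 1) (lp_norm 1) (mat_op A) \<longleftrightarrow>
          (\<lambda>r. SUP k. \<Sum>n. ennreal \<bar>ahat lam A (n + r) k\<bar>) \<longlonglongrightarrow> 0)))
     \<and>
     (A \<in> mat_class (ell_lam lam p) c_conv \<longrightarrow>
       (compact_operator (ell_lam lam p) (ell_lam_norm lam p) c_conv (lp_norm \<infinity>) (mat_op A) \<longleftrightarrow>
        (\<lambda>r. SUP n\<in>{r..}. lp_norm q (\<lambda>k. ahat lam A n k - alphahat lam A k)) \<longlonglongrightarrow> 0))"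
proof -
  interpret conjugate_pair p q
    using assms by unfold_locales
  note reduce = ell_lam_reduction[OF assms(1,2)]
  have null: "compact_operator (ell_lam lam p) (ell_lam_norm lam p) c_null (lp_norm \<infinity>) (mat_op A) \<longleftrightarrow>
      (\<lambda>r. SUP n\<in>{r..}. lp_norm q (ahat lam A n)) \<longlonglongrightarrow> 0"
    if "A \<in> mat_class (ell_lam lam p) c_null"
    unfolding reduce(2)[OF that] by (rule compact_into_c_null_iff[OF reduce(1)[OF that]])
  have series: "compact_operator (ell_lam lam p) (ell_lam_norm lam p) (ell 1) (lp_norm 1) (mat_op A) \<longleftrightarrow>
      (\<lambda>r. SUP N\<in>{N. finite N \<and> N \<subseteq> {r..}}. lp_norm q (\<lambda>k. \<Sum>n\<in>N. ahat lam A n k)) \<longlonglongrightarrow> 0"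
    if "A \<in> mat_class (ell_lam lam p) (ell 1)"
    unfolding reduce(2)[OF that] by (rule compact_into_ell_1_iff[OF reduce(1)[OF that]])
  \<comment> \<open>For \<open>p = 1\<close> the tail criterion is applied directly, with the exact
    column-sum formula in place of finite sets of rows.\<close>
  have series_1: "compact_operator (ell_lam lam p) (ell_lam_norm lam p) (ell 1) (lp_norm 1) (mat_op A) \<longleftrightarrow>
      (\<lambda>r. SUP k. \<Sum>n. ennreal \<bar>ahat lam A (n + r) k\<bar>) \<longlonglongrightarrow> 0"
    if "A \<in> mat_class (ell_lam lam p) (ell 1)" "p = 1"
    unfolding reduce(2)[OF that(1)]
      ell_1.compact_operator_iff_tails[OF conjugate_pair_axioms reduce(1)[OF that(1)]]
    unfolding that(2) SUP_series_tail_ell_1 ..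
  have conv: "compact_operator (ell_lam lam p) (ell_lam_norm lam p) c_conv (lp_norm \<infinity>) (mat_op A) \<longleftrightarrow>
      (\<lambda>r. SUP n\<in>{r..}. lp_norm q (\<lambda>k. ahat lam A n k - alphahat lam A k)) \<longlonglongrightarrow> 0"
    if "A \<in> mat_class (ell_lam lam p) c_conv"
    unfolding reduce(2)[OF that] alphahat_def by (rule compact_into_c_conv_iff[OF reduce(1)[OF that]])
  \<comment> \<open>At the endpoints \<open>lp_norm q\<close> is an absolute sum or a supremum,
    which turns \<open>null\<close> into the two special forms below.\<close>
  have q: "p = \<infinity> \<Longrightarrow> q = 1" "p = 1 \<Longrightarrow> q = \<infinity>"
    using assms(5) conjugate_exponents_1 conjugate_exponents_infinity by blast+
  have null_infinity: "compact_operator (ell_lam lam p) (ell_lam_norm lam p) c_null (lp_norm \<infinity>) (mat_op A) \<longleftrightarrow>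
      (\<lambda>r. SUP n\<in>{r..}. \<Sum>k. ennreal \<bar>ahat lam A n k\<bar>) \<longlonglongrightarrow> 0"
    if "A \<in> mat_class (ell_lam lam p) c_null" "p = \<infinity>"
    unfolding null[OF that(1)] q(1)[OF that(2)] lp_norm_1 ..
  have null_1: "compact_operator (ell_lam lam p) (ell_lam_norm lam p) c_null (lp_norm \<infinity>) (mat_op A) \<longleftrightarrow>
      (\<lambda>r. SUP n\<in>{r..}. SUP k. ennreal \<bar>ahat lam A n k\<bar>) \<longlonglongrightarrow> 0"
    if "A \<in> mat_class (ell_lam lam p) c_null" "p = 1"
    unfolding null[OF that(1)] unfolding q(2)[OF that(2)] lp_norm_infinity ..
  show ?thesis
    by (intro conjI impI null_infinity null null_1 series series_1 conv)
qed

end
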